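(* Let $\lambda$ be an infinite regular cardinal with $\lambda^{<\lambda}=\lambda$, and suppose there exists a $(\lambda^+,\lambda^{++})$-cardinal. Then there is a function $f:[\lambda^{++}]^2\rightarrow[\lambda^{++}]^{\leq\lambda}$ with collectionwise property $\Delta$; that is, whenever $\{a_\xi:\xi<\lambda^+\}$ is a collection of subsets of $\lambda^{++}$ each of cardinality $<\lambda$, there is $A\subseteq\lambda^+$ with $|A|=\lambda^+$ such that for all distinct $\xi,\xi'\in A$ and all $\tau\in a_\xi\cap a_{\xi'}$, $\alpha\in a_\xi\setminus a_{\xi'}$, $\beta\in a_{\xi'}\setminus a_\xi$ we have: (1) if $\tau<\alpha$ and $\tau<\beta$, then $\tau\in f(\alpha,\beta)$; (2) if $\beta>\tau$, then $f(\alpha,\tau)\subseteq f(\alpha,\beta)$; (3) if $\alpha>\tau$, then $f(\beta,\tau)\subseteq f(\alpha,\beta)$.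
   Context: Here $f(\alpha,\beta)$ means $f(\{\alpha,\beta\})$. Let $\kappa$ be a regular infinite cardinal. Notation: for sets $A,B$ of ordinals, $A<B$ means $\alpha<\beta$ for all $\alpha\in A,\beta\in B$. If $X,Y$ are sets of ordinals of the same order type, $f_{YX}$ denotes the unique order-preserving bijection from $X$ onto $Y$. For a family $\mu$ and a set $X$, $\mu|X=\{Y\in\mu: Y\subsetneq X\}$. For sets of ordinals $X_1,X_2$ of the same order type with $X_1\cap X_2<X_1\setminus X_2<X_2\setminus X_1$, write $X_1*X_2=X_1\cup X_2$ (otherwise $X_1*X_2$ is undefined). $\wp_\kappa(\kappa^+)=\{X\subseteq\kappa^+:|X|<\kappa\}$. For a family $\mu$ well-founded under strict inclusion, $rank(X)$ is the rank of $X\in\mu$ in $(\mu,\subsetneq)$. A $(\kappa,\kappa^+)$-cardinal is a family $\mu\subseteq\wp_\kappa(\kappa^+)$ such that: (1) $\mu$ is well-founded with respect to inclusion; (2) $|\mu|X|<\kappa$ for all $X\in\mu$; (3) if $X,Y\in\mu$ have the same rank, then they have the same order type and $\mu|Y=\{f_{YX}[Z]:Z\in\mu|X\}$; (4) for all $X,Y\in\mu$ there is $Z\in\mu$ with $X\cup Y\subseteq Z$; (5) for every $X\in\mu$, either $\mu|X$ is directed (any two members are contained in a common member of $\mu|X$), or there are $X_1,X_2\in\mu$ of the same rank with $X=X_1*X_2$ and $\mu|X=(\mu|X_1)\cup(\mu|X_2)\cup\{X_1,X_2\}$; (6) $\bigcup\mu=\kappa^+$; (7) every $X\in\mu$ of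 nonzero rank satisfies $X=\bigcup(\mu|X)$. A $(\lambda^+,\lambda^{++})$-cardinal is this notion with $\kappa=\lambda^+$. *)

theory Defs
  imports Main "HOL-Library.FuncSet" "HOL-Library.Ramsey"
begin

unbundle cardinal_syntax

text \<open>
  An infinite cardinal is a relation \<open>r\<close> with \<open>Cinfinite r\<close>; its elements are the members of
  \<open>Field r\<close>, well-ordered by the (reflexive) relation \<open>r\<close> itself in the least order type of its
  cardinality. So \<open>Field r\<close> plays the role of the set of ordinals below the cardinal, and
  \<open>underS r a\<close> the role of the ordinal \<open>a\<close> as a set. The successor cardinal is \<open>cardSuc r\<close>.
\<close>

definition olt :: "'a rel \<Rightarrow> 'a \<Rightarrow> 'a \<Rightarrow> bool" where
  "olt R a b \<longleftrightarrow> (a, b) \<in> R \<and> a \<noteq> b"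

definition set_olt :: "'a rel \<Rightarrow> 'a set \<Rightarrow> 'a set \<Rightarrow> bool" where
  "set_olt R A B \<longleftrightarrow> (\<forall>a\<in>A. \<forall>b\<in>B. olt R a b)"

definition same_otp :: "'a rel \<Rightarrow> 'a set \<Rightarrow> 'a set \<Rightarrow> bool" where
  "same_otp R X Y \<longleftrightarrow> Restr R X =o Restr R Y"

text \<open>\<open>otp_map R Y X\<close> is $f_{YX}$, the order isomorphism from \<open>X\<close> onto \<open>Y\<close>. It is made a
  unique function by requiring the value \<open>undefined\<close> outside \<open>X\<close>.\<close>

definition otp_map :: "'a rel \<Rightarrow> 'a set \<Rightarrow> 'a set \<Rightarrow> 'a \<Rightarrow> 'a" where
  "otp_map R Y X = (THE f. f \<in> extensional X \<and> iso (Restr R X) (Restr R Y) f)"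

text \<open>\<open>is_star R X X1 X2\<close> says that \<open>X1 * X2\<close> is defined and equal to \<open>X\<close>.\<close>

definition is_star :: "'a rel \<Rightarrow> 'a set \<Rightarrow> 'a set \<Rightarrow> 'a set \<Rightarrow> bool" where
  "is_star R X X1 X2 \<longleftrightarrow>
     same_otp R X1 X2 \<and> set_olt R (X1 \<inter> X2) (X1 - X2) \<and> set_olt R (X1 - X2) (X2 - X1) \<and>
     X = X1 \<union> X2"

definition below :: "'a set set \<Rightarrow> 'a set \<Rightarrow> 'a set set" where
  "below \<mu> X = {Y \<in> \<mu>. Y \<subset> X}"

definition directed_family :: "'a set set \<Rightarrow> bool" where
  "directed_family \<nu> \<longleftrightarrow> (\<forall>Y\<in>\<nu>. \<forall>Z\<in>\<nu>. \<exists>W\<in>\<nu>. Y \<union> Z \<subseteq> W)"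

text \<open>
  The rank of \<open>X\<close> in \<open>(\<mu>, \<subset>)\<close> is the least ordinal strictly above the ranks of all members of
  \<open>below \<mu> X\<close> (\<open>wo_rel.suc R B\<close> is the least strict upper bound of \<open>B\<close> in \<open>R\<close>). Every rank
  is below the successor of the cardinality of \<open>\<mu>\<close>, so that is where the ranks are taken;
  lemma \<open>rank_in\<close> shows that there is always enough room.
\<close>

definition rank_order :: "'a set set \<Rightarrow> 'a set set rel" where
  "rank_order \<mu> = cardSuc |\<mu>|"

definition rank :: "'a set set \<Rightarrow> 'a set \<Rightarrow> 'a set set" where
  "rank \<mu> = wfrec {(Y, X). X \<in> \<mu> \<and> Y \<in> below \<mu> X}
              (\<lambda>\<rho> X. wo_rel.suc (rank_order \<mu>) (\<rho> ` below \<mu> X))"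

text \<open>The ordinal \<open>0\<close> is the one without predecessors.\<close>

definition zero_rank :: "'a set set \<Rightarrow> 'a set \<Rightarrow> bool" where
  "zero_rank \<mu> X \<longleftrightarrow> underS (rank_order \<mu>) (rank \<mu> X) = {}"

definition two_cardinal :: "'k rel \<Rightarrow> 'k set set set \<Rightarrow> bool" where
  "two_cardinal \<kappa> \<mu> \<longleftrightarrow>
     (let R = cardSuc \<kappa> in
        Cinfinite \<kappa> \<and> regularCard \<kappa> \<and>
        \<mu> \<subseteq> {X. X \<subseteq> Field R \<and> |X| <o \<kappa>} \<and>
        wfp_on \<mu> (\<subset>) \<and>
        (\<forall>X\<in>\<mu>. |below \<mu> X| <o \<kappa>) \<and>
        (\<forall>X\<in>\<mu>. \<forall>Y\<in>\<mu>. rank \<mu> X = rank \<mu> Y \<longrightarrow>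
           same_otp R X Y \<and> below \<mu> Y = (\<lambda>Z. otp_map R Y X ` Z) ` below \<mu> X) \<and>
        (\<forall>X\<in>\<mu>. \<forall>Y\<in>\<mu>. \<exists>Z\<in>\<mu>. X \<union> Y \<subseteq> Z) \<and>
        (\<forall>X\<in>\<mu>. directed_family (below \<mu> X) \<or>
           (\<exists>X1\<in>\<mu>. \<exists>X2\<in>\<mu>. rank \<mu> X1 = rank \<mu> X2 \<and> is_star R X X1 X2 \<and>
              below \<mu> X = below \<mu> X1 \<union> below \<mu> X2 \<union> {X1, X2})) \<and>
        \<Union>\<mu> = Field R \<and>
        (\<forall>X\<in>\<mu>. \<not> zero_rank \<mu> X \<longrightarrow> X = \<Union>(below \<mu> X)))"

text \<open>\<open>weak_power r\<close> is the cardinal $r^{<r}$: the number of functions from some ordinal below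
  \<open>r\<close> to \<open>r\<close>.\<close>

definition weak_power :: "'a rel \<Rightarrow> ('a \<times> ('a \<Rightarrow> 'a)) rel" where
  "weak_power r = |SIGMA a:Field r. Func (underS r a) (Field r)|"

definition collectionwise_Delta :: "'a rel \<Rightarrow> ('a set set set \<Rightarrow> 'a set set set) \<Rightarrow> bool" where
  "collectionwise_Delta r f \<longleftrightarrow>
     (let \<kappa> = cardSuc r; R = cardSuc \<kappa> in
      \<forall>a. (\<forall>\<xi>\<in>Field \<kappa>. a \<xi> \<subseteq> Field R \<and> |a \<xi>| <o r) \<longrightarrow>
        (\<exists>A \<subseteq> Field \<kappa>. |A| =o \<kappa> \<and>
          (\<forall>\<xi>\<in>A. \<forall>\<xi>'\<in>A. \<xi> \<noteq> \<xi>' \<longrightarrow>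
            (\<forall>\<tau> \<in> a \<xi> \<inter> a \<xi>'. \<forall>\<alpha> \<in> a \<xi> - a \<xi>'. \<forall>\<beta> \<in> a \<xi>' - a \<xi>.
               (olt R \<tau> \<alpha> \<and> olt R \<tau> \<beta> \<longrightarrow> \<tau> \<in> f {\<alpha>, \<beta>}) \<and>
               (olt R \<tau> \<beta> \<longrightarrow> f {\<alpha>, \<tau>} \<subseteq> f {\<alpha>, \<beta>}) \<and>
               (olt R \<tau> \<alpha> \<longrightarrow> f {\<beta>, \<tau>} \<subseteq> f {\<alpha>, \<beta>})))))"

lemma otp_map_iso:
  assumes R: "Well_order R" and sub: "X \<subseteq> Field R" and otp: "same_otp R X Y"
  shows "otp_map R Y X \<in> extensional X" "iso (Restr R X) (Restr R Y) (otp_map R Y X)"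
proof -
  let ?P = "\<lambda>f. f \<in> extensional X \<and> iso (Restr R X) (Restr R Y) f"
  have W: "Well_order (Restr R Z)" for Z
    using R Well_order_Restr by blast
  have FX: "Field (Restr R X) = X"
    using R sub by (simp add: Refl_Field_Restr2 order_on_defs)
  obtain g where g: "iso (Restr R X) (Restr R Y) g"
    using otp by (auto simp: same_otp_def ordIso_def)
  have "iso (Restr R X) (Restr R Y) (restrict g X)"
    using g unfolding iso_iff2 FX by (simp cong: bij_betw_cong)
  then have ex: "?P (restrict g X)" by simp
  have uniq: "f = h" if "?P f" "?P h" for f h
  proof (rule extensionalityI[of _ X])
    show "f x = h x" if "x \<in> X" for x
      using embed_unique[OF W W, of X Y f h x] \<open>?P f\<close> \<open>?P h\<close> that
      unfolding iso_def FX by blast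
  qed (use that in blast)+
  have "?P (otp_map R Y X)"
    unfolding otp_map_def by (rule theI[of ?P, OF ex uniq[OF _ ex]])
  then show "otp_map R Y X \<in> extensional X" "iso (Restr R X) (Restr R Y) (otp_map R Y X)"
    by blast+
qed

lemma rank_order: "Card_order (rank_order \<mu>)" "Well_order (rank_order \<mu>)" "wo_rel (rank_order \<mu>)"
  "|\<mu>| <o rank_order \<mu>"
proof -
  have c: "Card_order |\<mu>|" by (rule card_of_Card_order)
  show *: "Card_order (rank_order \<mu>)"
    unfolding rank_order_def by (rule cardSuc_Card_order[OF c])
  show "Well_order (rank_order \<mu>)" using * by (rule card_order_on_well_order_on)
  show "wo_rel (rank_order \<mu>)" using * by (rule Card_order_wo_rel)
  show "|\<mu>| <o rank_order \<mu>"
    unfolding rank_order_def by (rule cardSuc_greater[OF c])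
qed

lemma rank_rec:
  assumes "wfp_on \<mu> (\<subset>)" "X \<in> \<mu>"
  shows "rank \<mu> X = wo_rel.suc (rank_order \<mu>) (rank \<mu> ` below \<mu> X)"
proof -
  let ?r = "{(Y, X). X \<in> \<mu> \<and> Y \<in> below \<mu> X}"
  have "wf ?r"
    unfolding wf_def
  proof (intro allI impI)
    fix P x assume H: "\<forall>x. (\<forall>y. (y, x) \<in> ?r \<longrightarrow> P y) \<longrightarrow> P x"
    have *: "P y" if "y \<in> \<mu>" for y
      using assms(1)
    proof (induction y rule: wfp_on_induct)
      case in_set
      show ?case by (rule that)
    next
      case (less y)
      have "P z" if "(z, y) \<in> ?r" for z
        using less.IH[of z] that by (simp add: below_def)
      then show ?case using H by blast
    qed
    have "P z" if "(z, x) \<in> ?r" for z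
      using *[of z] that by (simp add: below_def)
    then show "P x" using H by blast
  qed
  then have "rank \<mu> X = wo_rel.suc (rank_order \<mu>) (cut (rank \<mu>) ?r X ` below \<mu> X)"
    unfolding rank_def by (rule wfrec)
  also have "cut (rank \<mu>) ?r X ` below \<mu> X = rank \<mu> ` below \<mu> X"
    using assms(2) by (auto simp: cut_def below_def image_iff)
  finally show ?thesis .
qed

lemma rank_in:
  assumes wf: "wfp_on \<mu> (\<subset>)" and X: "X \<in> \<mu>"
  shows "rank \<mu> X \<in> AboveS (rank_order \<mu>) (rank \<mu> ` below \<mu> X)"
proof -
  let ?r = "rank_order \<mu>"
  note W = rank_order(3)[of \<mu>]
  have tot: "(a, b) \<in> ?r \<or> (b, a) \<in> ?r" if "a \<in> Field ?r" "b \<in> Field ?r" for a b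
    using wo_rel.TOTALS[OF W] that by blast
  have an: "a = b" if "(a, b) \<in> ?r" "(b, a) \<in> ?r" for a b
    using wo_rel.ANTISYM[OF W] that by (meson antisymD)
  have "rank \<mu> X \<in> AboveS ?r (rank \<mu> ` below \<mu> X) \<and> under ?r (rank \<mu> X) \<subseteq> rank \<mu> ` \<mu>"
    using wf
  proof (induction X rule: wfp_on_induct)
    case in_set
    show ?case by (rule X)
  next
    case (less X)
    define B where "B = rank \<mu> ` below \<mu> X"
    have IH: "b \<in> Field ?r" "under ?r b \<subseteq> rank \<mu> ` \<mu>" if "b \<in> B" for b
    proof -
      obtain Y where Y: "Y \<in> \<mu>" "Y \<subset> X" "b = rank \<mu> Y"
        using \<open>b \<in> B\<close> unfolding B_def below_def by blast
      show "b \<in> Field ?r" "under ?r b \<subseteq> rank \<mu> ` \<mu>"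
        using less.IH[OF Y(1,2)] unfolding Y(3) AboveS_def by blast+
    qed
    define D where "D = (\<Union>b\<in>B. under ?r b)"
    have "D \<subseteq> rank \<mu> ` \<mu>" using IH(2) by (auto simp: D_def)
    then have "|D| \<le>o |rank \<mu> ` \<mu>|" by (rule card_of_mono1)
    also have "|rank \<mu> ` \<mu>| \<le>o |\<mu>|" by (rule card_of_image)
    also have "|\<mu>| <o ?r" by (rule rank_order)
    also have "?r =o |Field ?r|"
      using rank_order(1) card_of_Field_ordIso ordIso_symmetric by blast
    finally have "\<not> Field ?r \<subseteq> D"
      using card_of_mono1 not_ordLess_ordLeq by blast
    then obtain c where c: "c \<in> Field ?r" "c \<notin> D" by blast
    have "b \<noteq> c \<and> (b, c) \<in> ?r" if b: "b \<in> B" for b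
    proof -
      have "(c, b) \<notin> ?r" using b c(2) by (auto simp: D_def under_def)
      then show ?thesis using tot[OF c(1) IH(1)[OF b]] tot[OF c(1) c(1)] by blast
    qed
    then have "c \<in> AboveS ?r B"
      using c(1) unfolding AboveS_def by blast
    then have ne: "AboveS ?r B \<noteq> {}" by blast
    have sub: "B \<subseteq> Field ?r" using IH by blast
    have eq: "rank \<mu> X = wo_rel.suc ?r B"
      unfolding B_def by (rule rank_rec[OF wf \<open>X \<in> \<mu>\<close>])
    have 1: "rank \<mu> X \<in> AboveS ?r B"
      unfolding eq by (rule wo_rel.suc_AboveS[OF W sub ne])
    have "a \<in> rank \<mu> ` \<mu>" if a: "(a, rank \<mu> X) \<in> ?r" for a
    proof (cases "a = rank \<mu> X")
      case True then show ?thesis using \<open>X \<in> \<mu>\<close> by blast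
    next
      case False
      have "a \<notin> AboveS ?r B"
      proof
        assume "a \<in> AboveS ?r B"
        then have "(rank \<mu> X, a) \<in> ?r"
          unfolding eq by (rule wo_rel.suc_least_AboveS[OF W])
        then show False using an[OF a] False by blast
      qed
      moreover have aF: "a \<in> Field ?r" using a by (auto simp: Field_def)
      ultimately obtain b where b: "b \<in> B" "\<not> (b \<noteq> a \<and> (b, a) \<in> ?r)"
        unfolding AboveS_def by blast
      then have "(a, b) \<in> ?r"
        using tot[OF aF IH(1)[OF b(1)]] tot[OF aF aF] by blast
      then have "a \<in> under ?r b" by (simp add: under_def)
      then show ?thesis using IH(2)[OF b(1)] by blast
    qed
    then have "under ?r (rank \<mu> X) \<subseteq> rank \<mu> ` \<mu>"
      unfolding under_def by blast
    then show ?case using 1 unfolding B_def by blast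
  qed
  then show ?thesis by blast
qed

end

theory Submission
  imports Defs
begin

text \<open>
  Let \<open>\<rho>(x, y)\<close> be the least rank of a member of \<open>\<mu>\<close> containing \<open>x\<close> and \<open>y\<close>, and let \<open>f {x, y}\<close> consist
  of the elements below both \<open>x\<close> and \<open>y\<close> of a member realising \<open>\<rho>(x, y)\<close>. If \<open>X\<close> has rank at most that
  of \<open>Y\<close>, then \<open>Y\<close> contains everything in \<open>X\<close> below a common element; hence \<open>\<rho>\<close> satisfies two
  of the three ultrametric inequalities, and property \<open>\<Delta>\<close> reduces to \<open>\<rho>(\<tau>, \<alpha>) \<le> \<rho>(\<alpha>, \<beta>)\<close> whenever \<open>\<alpha>, \<tau> < \<beta>\<close>.

  The crucial point is that for all \<open>x\<close>, \<open>y\<close> only finitely many values \<open>\<rho>(p, x)\<close> occur with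
  \<open>p < x, y\<close> and \<open>\<rho>(p, y) < \<rho>(p, x)\<close>: descending through the splittings \<open>Z = Z1 * Z2\<close>, each step
  adds at most the rank of \<open>Z\<close>. Collect these values for \<open>x, y \<in> a \<xi>\<close>, together with
  the values \<open>\<rho>(x, y)\<close>, in a set \<open>W \<xi>\<close> of size less than \<open>\<lambda>\<close>, and pass to a \<open>\<Delta>\<close>-system with root \<open>r\<close>. If
  the inequality fails, then \<open>\<rho>(\<tau>, \<alpha>)\<close> lies in \<open>W \<xi> \<inter> W \<xi>' = r\<close>. But \<open>r\<close> is bounded by a rank \<open>\<delta>\<close>,
  and one can thin out further so that \<open>\<rho>(\<alpha>, \<beta>) > \<delta>\<close>: the relation \<open>\<alpha> < \<beta> \<and> \<rho>(\<alpha>, \<beta>) \<le> \<delta>\<close> is a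
  tree order whose chains are injectively coloured by a fixed member of rank \<open>\<delta>\<close>, so after fixing
  the set of colours each \<open>\<beta>\<close> has fewer than \<open>\<lambda>\<close> relevant predecessors.
\<close>

section \<open>Delta-systems\<close>

text \<open>A small subset is enumerated along a proper initial segment of \<open>lam\<close>. Once
  \<open>e\<close> embeds \<open>M\<close> in \<open>Field lam\<close>, such enumerations are among
  the functions counted by \<open>weak_power lam\<close>, and \<open>\<phi>\<close> recovers the
  subset from the range.\<close>

lemma card_of_small_subsets:
  fixes lam :: "'a rel" and M :: "'b set"
  assumes lam: "Cinfinite lam" "weak_power lam =o lam" and M: "|M| \<le>o lam"
  shows "|{x. x \<subseteq> M \<and> |x| <o lam}| \<le>o lam"
proof -
  have W: "Well_order lam" using lam(1) card_order_on_well_order_on by blast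
  have "|Field lam| =o lam" using lam(1) card_of_Field_ordIso by blast
  then have "|M| \<le>o |Field lam|" using M ordIso_symmetric ordLeq_ordIso_trans by blast
  then obtain e where e: "inj_on e M" "e ` M \<subseteq> Field lam" unfolding card_of_ordLeq[symmetric] by blast
  define S where "S = (SIGMA a:Field lam. Func (underS lam a) (Field lam))"
  define \<phi> where "\<phi> = (\<lambda>(a, g). {m \<in> M. e m \<in> g ` underS lam a})"
  have "x \<in> \<phi> ` S" if x: "x \<subseteq> M" "|x| <o lam" for x
  proof -
    obtain a where a: "a \<in> Field lam" "|x| =o Restr lam (underS lam a)"
      using ordLess_iff_ordIso_Restr[OF W card_of_Well_order] x(2) by blast
    have us: "underS lam a \<subseteq> Field lam" by (auto simp: underS_def Field_def)
    have "Field (Restr lam (underS lam a)) = underS lam a"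
      by (rule Refl_Field_Restr2[OF _ us]) (use W in \<open>simp add: order_on_defs\<close>)
    then have "|x| =o |underS lam a|" using card_of_cong[OF a(2)] by (simp add: Field_card_of)
    then obtain k where k: "bij_betw k (underS lam a) x"
      using ordIso_symmetric card_of_ordIso by blast
    define g where "g = (\<lambda>i. if i \<in> underS lam a then e (k i) else undefined)"
    have "g i \<in> Field lam" if "i \<in> underS lam a" for i
      using bij_betwE[OF k] that x(1) e(2) unfolding g_def by auto
    then have "g \<in> Func (underS lam a) (Field lam)" unfolding Func_def g_def by simp
    then have "(a, g) \<in> S" unfolding S_def using a(1) by simp
    moreover have "g ` underS lam a = e ` x"
      using k unfolding g_def bij_betw_def by (auto simp: image_image)
    then have "\<phi> (a, g) = x"
      unfolding \<phi>_def using inj_on_image_mem_iff[OF e(1) _ x(1)] x(1) by auto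
    ultimately show ?thesis by (metis image_eqI)
  qed
  then have "|{x. x \<subseteq> M \<and> |x| <o lam}| \<le>o |\<phi> ` S|" by (intro card_of_mono1) blast
  also have "|\<phi> ` S| \<le>o |S|" by (rule card_of_image)
  also have "|S| =o lam" using lam(2) unfolding weak_power_def S_def .
  finally show ?thesis .
qed

text \<open>The closure is built in \<open>lam\<close> many stages. By regularity a small subset of
  the union already lies in one stage, and a later stage absorbs its image under
  \<open>F\<close>.\<close>

lemma exists_small_closure:
  fixes lam :: "'a rel" and F :: "'b set \<Rightarrow> 'b set"
  assumes lam: "Cinfinite lam" "regularCard lam" "weak_power lam =o lam"
    and F: "\<And>x. |x| <o lam \<Longrightarrow> |F x| \<le>o lam"
  shows "\<exists>M. |M| \<le>o lam \<and> (\<forall>x. x \<subseteq> M \<longrightarrow> |x| <o lam \<longrightarrow> F x \<subseteq> M)"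
proof -
  have card: "Card_order lam" and inf: "\<not> finite (Field lam)" using lam(1) by (auto simp: cinfinite_def)
  have W: "wo_rel lam" using card by (rule Card_order_wo_rel)
  note Un = card_of_UNION_ordLeq_infinite_Field[OF inf card]
  define G where "G S = S \<union> (\<Union>x\<in>{x. x \<subseteq> S \<and> |x| <o lam}. F x)" for S
  have G: "|G S| \<le>o lam" if "|S| \<le>o lam" for S
  proof -
    have "|\<Union>x\<in>{x. x \<subseteq> S \<and> |x| <o lam}. F x| \<le>o lam"
      by (rule Un[OF card_of_small_subsets[OF lam(1,3) that]]) (use F in blast)
    then show ?thesis unfolding G_def by (rule card_of_Un_ordLeq_infinite_Field[OF inf that _ card])
  qed
  \<comment> \<open>No base case is needed: the least index gives the empty union.\<close>
  define m where "m = wo_rel.worec lam (\<lambda>m i. \<Union>j\<in>underS lam i. G (m j))"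
  have m: "m i = (\<Union>j\<in>underS lam i. G (m j))" for i
  proof -
    have "wo_rel.adm_wo lam (\<lambda>m i. \<Union>j\<in>underS lam i. G (m j))"
      unfolding wo_rel.adm_wo_def[OF W] by auto
    from wo_rel.worec_fixpoint[OF W this] show ?thesis unfolding m_def by (rule fun_cong)
  qed
  have m_card: "|m i| \<le>o lam" if "i \<in> Field lam" for i
    using wo_rel.WF[OF W] that
  proof (induction i rule: wf_induct_rule)
    case (less i)
    have "|underS lam i| \<le>o lam" using card_of_underS[OF card less.prems] ordLess_imp_ordLeq by blast
    moreover have "|G (m j)| \<le>o lam" if "j \<in> underS lam i" for j
      using that less.IH[of j] by (intro G) (auto simp: underS_def Field_def)
    ultimately show ?case unfolding m[of i] by (intro Un) auto
  qed
  have chain: "relChain lam m"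
    unfolding relChain_def
  proof (intro allI impI)
    fix i j assume "(i, j) \<in> lam"
    then have "underS lam i \<subseteq> underS lam j"
      using wo_rel.TRANS[OF W] wo_rel.ANTISYM[OF W] unfolding underS_def by (auto dest: transD antisymD)
    then show "m i \<subseteq> m j" unfolding m[of i] m[of j] by blast
  qed
  define M where "M = (\<Union>i\<in>Field lam. m i)"
  have "|Field lam| \<le>o lam" using card card_of_Field_ordIso ordIso_iff_ordLeq by blast
  then have "|M| \<le>o lam" unfolding M_def by (intro Un) (use m_card in auto)
  moreover have "F x \<subseteq> M" if x: "x \<subseteq> M" "|x| <o lam" for x
  proof -
    obtain i where i: "i \<in> Field lam" "x \<subseteq> m i"
      using regularCard_UNION[OF card lam(2) chain _ x(2)] x(1) unfolding M_def by blast
    obtain j where j: "j \<in> Field lam" "i \<noteq> j" "(i, j) \<in> lam"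
      using infinite_Card_order_limit[OF card inf i(1)] by blast
    have "F x \<subseteq> G (m i)" unfolding G_def using i(2) x(2) by blast
    also have "\<dots> \<subseteq> m j" unfolding m[of j] using j by (auto simp: underS_def)
    also have "\<dots> \<subseteq> M" unfolding M_def using j(1) by blast
    finally show ?thesis .
  qed
  ultimately show ?thesis by blast
qed

lemma large_subset:
  fixes lam :: "'a rel"
  assumes "Cinfinite lam" "|I| =o cardSuc lam" "J \<subseteq> I" "\<not> |J| \<le>o lam"
  shows "|J| =o cardSuc lam"
proof -
  have card: "Card_order lam" using assms(1) by simp
  have "lam <o |J|" using assms(4) not_ordLeq_iff_ordLess[OF card_order_on_well_order_on[OF card] card_of_Well_order] by blast
  then have "cardSuc lam \<le>o |J|" using cardSuc_ordLess_ordLeq[OF card card_of_Card_order] by blast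
  moreover have "|J| \<le>o cardSuc lam" using card_of_mono1[OF assms(3)] assms(2) ordLeq_ordIso_trans by blast
  ultimately show ?thesis by (simp add: ordIso_iff_ordLeq)
qed

lemma not_large:
  fixes lam :: "'a rel"
  assumes "Cinfinite lam" "|I| =o cardSuc lam"
  shows "\<not> |I| \<le>o lam"
proof
  assume "|I| \<le>o lam"
  then have "cardSuc lam \<le>o lam" using assms(2) ordIso_symmetric ordIso_ordLeq_trans by blast
  moreover have "lam <o cardSuc lam" using assms(1) by (intro cardSuc_greater) simp
  ultimately show False using not_ordLess_ordLeq by blast
qed

text \<open>Pigeonhole principle: at most \<open>lam\<close> fibres, each of size at most
  \<open>lam\<close>, cannot cover a set of size \<open>cardSuc lam\<close>.\<close>

lemma large_fibre:
  fixes lam :: "'a rel"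
  assumes lam: "Cinfinite lam" and I: "|I| =o cardSuc lam" and g: "|g ` I| \<le>o lam"
  shows "\<exists>J c. J \<subseteq> I \<and> |J| =o cardSuc lam \<and> (\<forall>i\<in>J. g i = c)"
proof (rule ccontr)
  assume no: "\<not> ?thesis"
  have "|{i \<in> I. g i = c}| \<le>o lam" for c
  proof (rule ccontr)
    assume "\<not> |{i \<in> I. g i = c}| \<le>o lam"
    then have "|{i \<in> I. g i = c}| =o cardSuc lam" by (intro large_subset[OF lam I]) auto
    then have "{i \<in> I. g i = c} \<subseteq> I \<and> |{i \<in> I. g i = c}| =o cardSuc lam \<and> (\<forall>i\<in>{i \<in> I. g i = c}. g i = c)"
      by simp
    then show False using no by (elim notE, intro exI)
  qed
  then have "|\<Union>c\<in>g ` I. {i \<in> I. g i = c}| \<le>o lam"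
    using lam by (intro card_of_UNION_ordLeq_infinite_Field[OF _ _ g]) (auto simp: cinfinite_def)
  moreover have "(\<Union>c\<in>g ` I. {i \<in> I. g i = c}) = I" by blast
  ultimately show False using not_large[OF lam I] by simp
qed

text \<open>
  Take a maximal \<open>\<Delta>\<close>-system \<open>B d\<close> for each possible root \<open>d\<close>. If all of these are small, some \<open>M\<close> of size \<open>\<lambda>\<close>
  contains the sets indexed by \<open>B d\<close> for every small \<open>d \<subseteq> M\<close>, and then a new index \<open>i\<close> extends
  \<open>B (a i \<inter> M)\<close>.
\<close>

lemma Delta_system:
  fixes lam :: "'a rel" and a :: "'i \<Rightarrow> 'b set"
  assumes lam: "Cinfinite lam" "regularCard lam" "weak_power lam =o lam"
    and I: "|I| =o cardSuc lam" and a: "\<And>i. i \<in> I \<Longrightarrow> |a i| <o lam"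
  shows "\<exists>J d. J \<subseteq> I \<and> |J| =o cardSuc lam \<and> |d| <o lam \<and> (\<forall>i\<in>J. d \<subseteq> a i) \<and>
    (\<forall>i\<in>J. \<forall>j\<in>J. i \<noteq> j \<longrightarrow> a i \<inter> a j = d)"
proof (rule ccontr)
  assume no: "\<not> ?thesis"
  have card: "Card_order lam" and inf: "\<not> finite (Field lam)" using lam(1) by (auto simp: cinfinite_def)
  note Un = card_of_UNION_ordLeq_infinite_Field[OF inf card]
  define \<F> where "\<F> d = {J. J \<subseteq> I \<and> (\<forall>i\<in>J. d \<subseteq> a i) \<and> (\<forall>i\<in>J. \<forall>j\<in>J. i \<noteq> j \<longrightarrow> a i \<inter> a j = d)}" for d
  have "\<exists>J\<in>\<F> d. \<forall>X\<in>\<F> d. J \<subseteq> X \<longrightarrow> X = J" for d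
  proof (rule subset_Zorn')
    fix C assume C: "subset.chain (\<F> d) C"
    show "\<Union>C \<in> \<F> d"
      unfolding \<F>_def
    proof (intro CollectI conjI ballI impI)
      show "\<Union>C \<subseteq> I" using C unfolding subset_chain_def \<F>_def by blast
      show "d \<subseteq> a i" if "i \<in> \<Union>C" for i using C that unfolding subset_chain_def \<F>_def by blast
      fix i j assume ij: "i \<in> \<Union>C" "j \<in> \<Union>C" "i \<noteq> j"
      then obtain X Y where "X \<in> C" "Y \<in> C" "i \<in> X" "j \<in> Y" by blast
      moreover from this have "X \<subseteq> Y \<or> Y \<subseteq> X" using C unfolding subset_chain_def by blast
      ultimately obtain Z where "Z \<in> C" "i \<in> Z" "j \<in> Z" by blast
      then show "a i \<inter> a j = d" using C ij(3) unfolding subset_chain_def \<F>_def by blast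
    qed
  qed
  then obtain B where B: "\<And>d. B d \<in> \<F> d" "\<And>d X. X \<in> \<F> d \<Longrightarrow> B d \<subseteq> X \<Longrightarrow> X = B d" by metis
  have B_mem: "B d \<subseteq> I" "\<forall>i\<in>B d. d \<subseteq> a i" "\<forall>i\<in>B d. \<forall>j\<in>B d. i \<noteq> j \<longrightarrow> a i \<inter> a j = d" for d
    using B(1)[of d] unfolding \<F>_def by simp_all
  have B_card: "|B d| \<le>o lam" if d: "|d| <o lam" for d
  proof (rule ccontr)
    assume "\<not> |B d| \<le>o lam"
    then have "|B d| =o cardSuc lam" by (rule large_subset[OF lam(1) I B_mem(1)])
    with B_mem[of d] d have "B d \<subseteq> I \<and> |B d| =o cardSuc lam \<and> |d| <o lam \<and> (\<forall>i\<in>B d. d \<subseteq> a i) \<and>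
      (\<forall>i\<in>B d. \<forall>j\<in>B d. i \<noteq> j \<longrightarrow> a i \<inter> a j = d)" by simp
    then show False using no by (elim notE, intro exI)
  qed
  have "|\<Union>i\<in>B d. a i| \<le>o lam" if "|d| <o lam" for d
  proof (rule Un[OF B_card[OF that]], intro ballI)
    fix i assume "i \<in> B d"
    then show "|a i| \<le>o lam" using B_mem(1)[of d] a ordLess_imp_ordLeq by blast
  qed
  from exists_small_closure[OF lam, of "\<lambda>d. \<Union>i\<in>B d. a i", OF this]
  obtain M where M: "|M| \<le>o lam" "\<And>d. d \<subseteq> M \<Longrightarrow> |d| <o lam \<Longrightarrow> (\<Union>i\<in>B d. a i) \<subseteq> M"
    by blast
  have "|\<Union>d\<in>{d. d \<subseteq> M \<and> |d| <o lam}. B d| \<le>o lam"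
    by (rule Un[OF card_of_small_subsets[OF lam(1,3) M(1)]]) (use B_card in blast)
  then have "\<not> I \<subseteq> (\<Union>d\<in>{d. d \<subseteq> M \<and> |d| <o lam}. B d)"
    using not_large[OF lam(1) I] card_of_mono1 ordLeq_transitive by blast
  then obtain i where i: "i \<in> I" "\<And>d. d \<subseteq> M \<Longrightarrow> |d| <o lam \<Longrightarrow> i \<notin> B d" by blast
  define d where "d = a i \<inter> M"
  have d: "d \<subseteq> M" "d \<subseteq> a i" by (auto simp: d_def)
  have d_small: "|d| <o lam" using card_of_mono1[OF d(2)] a[OF i(1)] ordLeq_ordLess_trans by blast
  have new: "a i \<inter> a j = d" if "j \<in> B d" for j
  proof -
    have "a j \<subseteq> M" using M(2)[OF d(1) d_small] that by blast
    moreover have "d \<subseteq> a j" using B_mem(2)[of d] that by blast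
    ultimately show ?thesis by (auto simp: d_def)
  qed
  have "insert i (B d) \<in> \<F> d"
    unfolding \<F>_def
  proof (intro CollectI conjI ballI impI)
    show "insert i (B d) \<subseteq> I" using B_mem(1)[of d] i(1) by blast
    show "d \<subseteq> a j" if "j \<in> insert i (B d)" for j using B_mem(2)[of d] d(2) that by blast
    fix j k assume jk: "j \<in> insert i (B d)" "k \<in> insert i (B d)" "j \<noteq> k"
    show "a j \<inter> a k = d"
    proof (cases "j = i \<or> k = i")
      case True
      then show ?thesis using jk new by (auto simp: Int_commute)
    next
      case False
      then show ?thesis using jk B_mem(3)[of d] by blast
    qed
  qed
  then have "insert i (B d) = B d" using B(2) by blast
  then show False using i(2)[OF d(1) d_small] by blast
qed

section \<open>Coherence\<close>

text \<open>Rigidity of well-orders. At a least point of disagreement, the smaller value is attained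
  by the other map at an earlier point of \<open>I\<close>, where both maps agree; this contradicts
  injectivity.\<close>

lemma iso_agree_on_initial:
  assumes R: "Well_order R" and sub: "X \<subseteq> Field R" "Y \<subseteq> Field R" "Z \<subseteq> Field R"
    and f: "bij_betw f X Z" "\<And>a b. a \<in> X \<Longrightarrow> b \<in> X \<Longrightarrow> (a, b) \<in> R \<longleftrightarrow> (f a, f b) \<in> R"
    and g: "bij_betw g Y Z" "\<And>a b. a \<in> Y \<Longrightarrow> b \<in> Y \<Longrightarrow> (a, b) \<in> R \<longleftrightarrow> (g a, g b) \<in> R"
    and I: "I \<subseteq> X \<inter> Y" "\<And>i x. i \<in> I \<Longrightarrow> x \<in> X \<union> Y \<Longrightarrow> (x, i) \<in> R \<Longrightarrow> x \<in> I"
    and i: "i \<in> I"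
  shows "f i = g i"
proof -
  have W: "wo_rel R" using R by (simp add: wo_rel_def)
  have tot: "(a, b) \<in> R \<or> (b, a) \<in> R" if "a \<in> Field R" "b \<in> Field R" for a b
    using wo_rel.TOTALS[OF W] that by blast
  have an: "a = b" if "(a, b) \<in> R" "(b, a) \<in> R" for a b
    using wo_rel.ANTISYM[OF W] that by (meson antisymD)
  \<comment> \<open>Stated for arbitrary \<open>h\<close> and \<open>k\<close>, so that it excludes
    both strict inequalities between \<open>f i\<close> and \<open>g i\<close>.\<close>
  have key: "(h i, k i) \<notin> R \<or> h i = k i"
    if IH: "\<And>j. j \<in> I \<Longrightarrow> (j, i) \<in> R \<Longrightarrow> j \<noteq> i \<Longrightarrow> h j = k j" and i: "i \<in> I" and I: "I \<subseteq> A \<inter> B"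
      "\<And>i x. i \<in> I \<Longrightarrow> x \<in> A \<union> B \<Longrightarrow> (x, i) \<in> R \<Longrightarrow> x \<in> I"
      and h: "bij_betw h A Z" and k: "bij_betw k B Z" "\<And>a b. a \<in> B \<Longrightarrow> b \<in> B \<Longrightarrow> (a, b) \<in> R \<longleftrightarrow> (k a, k b) \<in> R"
    for h k A B i
  proof (rule ccontr)
    assume "\<not> ?thesis"
    then have c: "(h i, k i) \<in> R" "h i \<noteq> k i" by auto
    have "h i \<in> Z" using h i I by (auto simp: bij_betw_def)
    then obtain j where j: "j \<in> B" "k j = h i" using k by (auto simp: bij_betw_def)
    have ji: "(j, i) \<in> R" using c j k(2)[of j i] i I(1) by auto
    then have jI: "j \<in> I" using I(2)[OF i, of j] j by blast
    have "j \<noteq> i" using j c by auto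
    then have "h j = h i" using IH[OF jI ji] j by simp
    then have "j = i" using h i jI I(1) unfolding bij_betw_def inj_on_def by blast
    with \<open>j \<noteq> i\<close> show False by simp
  qed
  have "wf (R - Id)" using wo_rel.WF[OF W] .
  then show ?thesis using i
  proof (induction i rule: wf_induct_rule)
    case (less i)
    have IH: "f j = g j" if "j \<in> I" "(j, i) \<in> R" "j \<noteq> i" for j
      using less.IH[of j] that by auto
    have 1: "(f i, g i) \<notin> R \<or> f i = g i"
      using IH less.prems I by (intro key[where A=X and B=Y, OF _ _ _ _ f(1) g]) auto
    have 2: "(g i, f i) \<notin> R \<or> g i = f i"
      using IH less.prems I by (intro key[where A=Y and B=X, OF _ _ _ _ g(1) f]) auto
    have "f i \<in> Field R" "g i \<in> Field R"
      using less.prems I(1) bij_betwE[OF f(1)] bij_betwE[OF g(1)] sub(3) by blast+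
    with 1 2 tot show ?case by metis
  qed
qed

section \<open>The axioms, and comparison of members by rank\<close>

locale two_cardinal_family =
  fixes \<kappa> :: "'k rel" and \<mu> :: "'k set set set"
  assumes two_cardinal: "two_cardinal \<kappa> \<mu>"
begin

abbreviation "R \<equiv> cardSuc \<kappa>"

lemma kappa_Cinfinite: "Cinfinite \<kappa>"
  using two_cardinal unfolding two_cardinal_def Let_def by (rule conjunct1)

lemma kappa_regular: "regularCard \<kappa>" and psubset_wf: "wfp_on \<mu> (\<subset>)" and Union_members: "\<Union>\<mu> = Field R"
  using two_cardinal unfolding two_cardinal_def Let_def by - (elim conjE, assumption)+

lemma members_directed: "X \<in> \<mu> \<Longrightarrow> Y \<in> \<mu> \<Longrightarrow> \<exists>Z\<in>\<mu>. X \<union> Y \<subseteq> Z"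
proof -
  have "\<forall>X\<in>\<mu>. \<forall>Y\<in>\<mu>. \<exists>Z\<in>\<mu>. X \<union> Y \<subseteq> Z"
    using two_cardinal unfolding two_cardinal_def Let_def by (elim conjE)
  then show "X \<in> \<mu> \<Longrightarrow> Y \<in> \<mu> \<Longrightarrow> \<exists>Z\<in>\<mu>. X \<union> Y \<subseteq> Z" by blast
qed

lemma member_sub: "X \<in> \<mu> \<Longrightarrow> X \<subseteq> Field R"
  and member_small: "X \<in> \<mu> \<Longrightarrow> |X| <o \<kappa>"
proof -
  have "\<mu> \<subseteq> {X. X \<subseteq> Field R \<and> |X| <o \<kappa>}"
    using two_cardinal unfolding two_cardinal_def Let_def by (elim conjE)
  then show "X \<in> \<mu> \<Longrightarrow> X \<subseteq> Field R" "X \<in> \<mu> \<Longrightarrow> |X| <o \<kappa>" by blast+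
qed

lemma same_rank:
  assumes "X \<in> \<mu>" "Y \<in> \<mu>" "rank \<mu> X = rank \<mu> Y"
  shows "same_otp R X Y" "below \<mu> Y = (\<lambda>Z. otp_map R Y X ` Z) ` below \<mu> X"
proof -
  have "\<forall>X\<in>\<mu>. \<forall>Y\<in>\<mu>. rank \<mu> X = rank \<mu> Y \<longrightarrow>
      same_otp R X Y \<and> below \<mu> Y = (\<lambda>Z. otp_map R Y X ` Z) ` below \<mu> X"
    using two_cardinal unfolding two_cardinal_def Let_def by (elim conjE)
  with assms show "same_otp R X Y" "below \<mu> Y = (\<lambda>Z. otp_map R Y X ` Z) ` below \<mu> X" by blast+
qed

lemma nonzero_rank:
  assumes "X \<in> \<mu>" "\<not> zero_rank \<mu> X" shows "X = \<Union>(below \<mu> X)"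
proof -
  have "\<forall>X\<in>\<mu>. \<not> zero_rank \<mu> X \<longrightarrow> X = \<Union>(below \<mu> X)"
    using two_cardinal unfolding two_cardinal_def Let_def by (elim conjE)
  with assms show ?thesis by blast
qed

lemma member_cases [consumes 1, case_names directed star]:
  assumes "X \<in> \<mu>"
  obtains "directed_family (below \<mu> X)"
  | X1 X2 where "X1 \<in> \<mu>" "X2 \<in> \<mu>" "rank \<mu> X1 = rank \<mu> X2" "is_star R X X1 X2"
      "below \<mu> X = below \<mu> X1 \<union> below \<mu> X2 \<union> {X1, X2}"
proof -
  have "\<forall>X\<in>\<mu>. directed_family (below \<mu> X) \<or>
           (\<exists>X1\<in>\<mu>. \<exists>X2\<in>\<mu>. rank \<mu> X1 = rank \<mu> X2 \<and> is_star R X X1 X2 \<and>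
              below \<mu> X = below \<mu> X1 \<union> below \<mu> X2 \<union> {X1, X2})"
    using two_cardinal unfolding two_cardinal_def Let_def by (elim conjE)
  with assms that show thesis by blast
qed

lemma R_wo_rel: "wo_rel R" and R_Well_order: "Well_order R"
proof -
  show "Well_order R" using kappa_Cinfinite cardSuc_Card_order card_order_on_well_order_on by blast
  then show "wo_rel R" by (simp add: wo_rel_def)
qed

lemma R_total: "a \<in> Field R \<Longrightarrow> b \<in> Field R \<Longrightarrow> (a, b) \<in> R \<or> (b, a) \<in> R"
  using wo_rel.TOTALS[OF R_wo_rel] by blast

lemma R_refl: "a \<in> Field R \<Longrightarrow> (a, a) \<in> R"
  using R_total by blast

lemma R_antisym: "(a, b) \<in> R \<Longrightarrow> (b, a) \<in> R \<Longrightarrow> a = b"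
  using wo_rel.ANTISYM[OF R_wo_rel] by (meson antisymD)

lemma R_trans: "(a, b) \<in> R \<Longrightarrow> (b, c) \<in> R \<Longrightarrow> (a, c) \<in> R"
  using wo_rel.TRANS[OF R_wo_rel] by (meson transD)

definition rank_le :: "'k set set \<Rightarrow> 'k set set \<Rightarrow> bool" (infix "\<preceq>" 50) where
  "X \<preceq> Y \<longleftrightarrow> (rank \<mu> X, rank \<mu> Y) \<in> rank_order \<mu>"

lemma rank_Field: "X \<in> \<mu> \<Longrightarrow> rank \<mu> X \<in> Field (rank_order \<mu>)"
  using rank_in[OF psubset_wf] unfolding AboveS_def by blast

lemma rank_le_total: "X \<in> \<mu> \<Longrightarrow> Y \<in> \<mu> \<Longrightarrow> X \<preceq> Y \<or> Y \<preceq> X"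
  using wo_rel.TOTALS[OF rank_order(3)[of \<mu>]] rank_Field unfolding rank_le_def by blast

lemma rank_le_refl: "X \<in> \<mu> \<Longrightarrow> X \<preceq> X"
  using rank_le_total by blast

lemma rank_le_trans: "X \<preceq> Y \<Longrightarrow> Y \<preceq> Z \<Longrightarrow> X \<preceq> Z"
  using wo_rel.TRANS[OF rank_order(3)[of \<mu>]] unfolding rank_le_def by (meson transD)

lemma rank_le_antisym: "X \<preceq> Y \<Longrightarrow> Y \<preceq> X \<Longrightarrow> rank \<mu> X = rank \<mu> Y"
  using wo_rel.ANTISYM[OF rank_order(3)[of \<mu>]] unfolding rank_le_def by (meson antisymD)

lemma rank_eq_le: "X \<in> \<mu> \<Longrightarrow> rank \<mu> X = rank \<mu> Y \<Longrightarrow> X \<preceq> Y"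
  using rank_le_refl unfolding rank_le_def by metis

lemma rank_le_cong: "rank \<mu> X = rank \<mu> X' \<Longrightarrow> rank \<mu> Y = rank \<mu> Y' \<Longrightarrow> X \<preceq> Y \<longleftrightarrow> X' \<preceq> Y'"
  unfolding rank_le_def by simp

lemma rank_strict: "Y \<in> \<mu> \<Longrightarrow> X \<in> \<mu> \<Longrightarrow> Y \<subset> X \<Longrightarrow> Y \<preceq> X \<and> \<not> X \<preceq> Y"
proof -
  assume *: "Y \<in> \<mu>" "X \<in> \<mu>" "Y \<subset> X"
  then have "rank \<mu> Y \<in> rank \<mu> ` below \<mu> X" by (auto simp: below_def)
  then have "rank \<mu> Y \<noteq> rank \<mu> X \<and> Y \<preceq> X"
    using rank_in[OF psubset_wf *(2)] unfolding AboveS_def rank_le_def by auto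
  then show ?thesis using rank_le_antisym by metis
qed

lemma rank_mono: "Y \<in> \<mu> \<Longrightarrow> X \<in> \<mu> \<Longrightarrow> Y \<subseteq> X \<Longrightarrow> Y \<preceq> X"
  using rank_strict rank_le_refl by (metis psubsetI)

lemma same_rank_sub: "X \<in> \<mu> \<Longrightarrow> Y \<in> \<mu> \<Longrightarrow> X \<subseteq> Y \<Longrightarrow> rank \<mu> X = rank \<mu> Y \<Longrightarrow> X = Y"
  using rank_strict rank_eq_le by (metis psubsetI)

text \<open>By totality the hypothesis makes the rank of \<open>Y\<close> a strict upper bound of
  the ranks below \<open>X\<close>, and the rank of \<open>X\<close> is the least one.\<close>

lemma rank_least:
  assumes "X \<in> \<mu>" "Y \<in> \<mu>" "\<And>W. W \<in> below \<mu> X \<Longrightarrow> \<not> Y \<preceq> W"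
  shows "X \<preceq> Y"
proof -
  have "(rank \<mu> W, rank \<mu> Y) \<in> rank_order \<mu> \<and> rank \<mu> W \<noteq> rank \<mu> Y" if W: "W \<in> below \<mu> X" for W
  proof -
    have m: "W \<in> \<mu>" using W by (auto simp: below_def)
    show ?thesis
      using assms(3)[OF W] rank_le_total[OF m assms(2)] rank_le_refl[OF m] unfolding rank_le_def by auto
  qed
  then have "rank \<mu> Y \<in> AboveS (rank_order \<mu>) (rank \<mu> ` below \<mu> X)"
    using rank_Field[OF assms(2)] unfolding AboveS_def by auto
  then show ?thesis
    unfolding rank_le_def rank_rec[OF psubset_wf assms(1)]
    by (rule wo_rel.suc_least_AboveS[OF rank_order(3)])
qed

section \<open>Members of prescribed rank through a given point\<close>

lemma exists_member: "a \<in> Field R \<Longrightarrow> \<exists>X\<in>\<mu>. a \<in> X"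
  using Union_members by blast

lemma exists_member2:
  assumes "a \<in> Field R" "b \<in> Field R" shows "\<exists>X\<in>\<mu>. a \<in> X \<and> b \<in> X"
  using exists_member[OF assms(1)] exists_member[OF assms(2)] members_directed by (meson UnCI subsetD)

lemma star_members:
  assumes "X1 \<in> \<mu>" "X2 \<in> \<mu>" "below \<mu> X = below \<mu> X1 \<union> below \<mu> X2 \<union> {X1, X2}" "W \<in> below \<mu> X"
  shows "W \<in> \<mu> \<and> (W \<subseteq> X1 \<or> W \<subseteq> X2)"
  using assms by (auto simp: below_def)

text \<open>As long as the rank of \<open>Z\<close> exceeds that of \<open>X\<close>, some member
  properly inside \<open>Z\<close> still contains \<open>z\<close> and has rank at least that of
  \<open>X\<close>. Well-foundedness ends the descent at exactly this rank.\<close>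

lemma descend:
  assumes "Z \<in> \<mu>" "X \<in> \<mu>" "X \<preceq> Z" "z \<in> Z"
  shows "\<exists>Y\<in>\<mu>. Y \<subseteq> Z \<and> z \<in> Y \<and> rank \<mu> Y = rank \<mu> X"
  using psubset_wf assms(1,3,4)
proof (induction Z rule: wfp_on_induct)
  case in_set
  then show ?case using assms(1) by simp
next
  case (less Z)
  show ?case
  proof (cases "Z \<preceq> X")
    case True
    then show ?thesis using less.prems less.hyps rank_le_antisym by blast
  next
    case False
    \<comment> \<open>The rank of \<open>Z\<close> is the least strict upper bound of the ranks
      below it, so the smaller rank of \<open>X\<close> is not one. \<open>W\<close> need not
      contain \<open>z\<close>; that is repaired by directedness or by passing to the half that
      contains \<open>z\<close>.\<close>
    then obtain W where W: "W \<in> below \<mu> Z" "X \<preceq> W"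
      using rank_least[OF less.hyps assms(2)] by blast
    have "\<exists>U\<in>below \<mu> Z. X \<preceq> U \<and> z \<in> U"
      using less.hyps
    proof (cases rule: member_cases)
      case directed
      have "rank \<mu> X \<noteq> rank \<mu> Z"
        using False rank_eq_le[of X Z] rank_eq_le[of Z X] less.hyps by metis
      then have "\<not> zero_rank \<mu> Z"
        using less.prems unfolding zero_rank_def underS_def rank_le_def by blast
      then obtain V where V: "V \<in> below \<mu> Z" "z \<in> V"
        using nonzero_rank[OF less.hyps] less.prems by blast
      obtain U where U: "U \<in> below \<mu> Z" "V \<union> W \<subseteq> U"
        using directed V W unfolding directed_family_def by blast
      then have "W \<preceq> U" using W by (intro rank_mono) (auto simp: below_def)
      then show ?thesis using U V W rank_le_trans by blast
    next
      case (star X1 X2)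
      have "W \<preceq> X1 \<or> W \<preceq> X2"
        using star_members[OF star(1,2,5) W(1)] star rank_mono by blast
      then have "X \<preceq> X1 \<and> X \<preceq> X2"
        using W(2) star(3) rank_le_trans rank_le_cong by metis
      then show ?thesis using star(4,5) less.prems unfolding is_star_def by blast
    qed
    then obtain U where "U \<in> \<mu>" "U \<subset> Z" "X \<preceq> U" "z \<in> U" by (auto simp: below_def)
    then show ?thesis using less.IH[of U] by blast
  qed
qed

lemma exists_same_rank:
  assumes "X \<in> \<mu>" "z \<in> Field R"
  shows "\<exists>Y\<in>\<mu>. z \<in> Y \<and> rank \<mu> Y = rank \<mu> X"
proof -
  obtain V where "V \<in> \<mu>" "z \<in> V" using exists_member assms by blast
  then obtain Z where Z: "Z \<in> \<mu>" "X \<union> V \<subseteq> Z" using members_directed assms by blast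
  then show ?thesis
    using descend[OF Z(1) assms(1), of z] rank_mono[OF assms(1) Z(1)] \<open>z \<in> V\<close> by blast
qed

section \<open>Transport along the order isomorphisms\<close>

lemma otp_map_bij:
  assumes "X \<in> \<mu>" "Y \<in> \<mu>" "rank \<mu> X = rank \<mu> Y"
  shows "bij_betw (otp_map R Y X) X Y"
    and "a \<in> X \<Longrightarrow> b \<in> X \<Longrightarrow> (a, b) \<in> R \<longleftrightarrow> (otp_map R Y X a, otp_map R Y X b) \<in> R"
proof -
  have F: "Field (Restr R A) = A" if "A \<in> \<mu>" for A
    by (rule Refl_Field_Restr2[OF wo_rel.REFL[OF R_wo_rel] member_sub[OF that]])
  have "iso (Restr R X) (Restr R Y) (otp_map R Y X)"
    by (rule otp_map_iso(2)[OF R_Well_order member_sub[OF assms(1)] same_rank(1)[OF assms]])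
  then have *: "bij_betw (otp_map R Y X) X Y"
    "\<forall>a\<in>X. \<forall>b\<in>X. (a, b) \<in> Restr R X \<longleftrightarrow> (otp_map R Y X a, otp_map R Y X b) \<in> Restr R Y"
    unfolding iso_iff2 F[OF assms(1)] F[OF assms(2)] by simp_all
  then show "bij_betw (otp_map R Y X) X Y" by simp
  show "(a, b) \<in> R \<longleftrightarrow> (otp_map R Y X a, otp_map R Y X b) \<in> R" if "a \<in> X" "b \<in> X"
    using *(2)[rule_format, OF that] bij_betwE[OF *(1)] that by simp
qed

text \<open>The homogeneity axiom \<open>same_rank\<close> matches the members below
  \<open>X\<close> with those below \<open>Y\<close>. The matching preserves and reflects strict
  inclusion, from which ranks are computed recursively, so it preserves ranks.\<close>

lemma otp_map_image:
  assumes XY: "X \<in> \<mu>" "Y \<in> \<mu>" "rank \<mu> X = rank \<mu> Y" and W: "W \<in> \<mu>" "W \<subseteq> X"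
  shows "otp_map R Y X ` W \<in> \<mu>" "otp_map R Y X ` W \<subseteq> Y" "rank \<mu> (otp_map R Y X ` W) = rank \<mu> W"
proof -
  let ?f = "otp_map R Y X"
  note bij = otp_map_bij(1)[OF XY]
  have "?f ` U \<subseteq> ?f ` V \<longleftrightarrow> U \<subseteq> V" if "U \<subseteq> X" "V \<subseteq> X" for U V
  proof
    assume *: "?f ` U \<subseteq> ?f ` V"
    show "U \<subseteq> V"
    proof
      fix x assume "x \<in> U"
      then show "x \<in> V"
        using * that inj_on_image_mem_iff[OF bij_betw_imp_inj_on[OF bij], of x V] by auto
    qed
  qed (rule image_mono)
  then have inj: "?f ` U \<subset> ?f ` V \<longleftrightarrow> U \<subset> V" if "U \<subseteq> X" "V \<subseteq> X" for U V
    using that by (simp add: less_le_not_le)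
  have step: "?f ` U \<in> below \<mu> Y" if "U \<in> below \<mu> X" for U
    unfolding same_rank(2)[OF XY] using that by (rule imageI)
  have rk: "rank \<mu> (?f ` U) = rank \<mu> U" if U: "U \<in> below \<mu> X" for U
  proof -
    have U\<mu>: "U \<in> \<mu>" using U by (auto simp: below_def)
    show ?thesis using psubset_wf U
    proof (induction U rule: wfp_on_induct)
      case in_set then show ?case using U\<mu> by simp
    next
      case (less U)
      have UX: "U \<subseteq> X" using less.prems by (auto simp: below_def)
      have "below \<mu> (?f ` U) = (`) ?f ` below \<mu> U"
      proof (intro set_eqI iffI)
        fix V assume V: "V \<in> below \<mu> (?f ` U)"
        then have "V \<in> below \<mu> Y" using step[OF less.prems] by (auto simp: below_def)
        then obtain V' where V': "V' \<in> below \<mu> X" "V = ?f ` V'"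
          unfolding same_rank(2)[OF XY] by (elim imageE)
        then have "V' \<subset> U" using V inj[of V' U] UX by (auto simp: below_def)
        then show "V \<in> (`) ?f ` below \<mu> U" using V' by (auto simp: below_def)
      next
        fix V assume "V \<in> (`) ?f ` below \<mu> U"
        then obtain V' where V': "V' \<in> \<mu>" "V' \<subset> U" "V = ?f ` V'" by (auto simp: below_def)
        then have "V' \<in> below \<mu> X" using UX by (auto simp: below_def)
        then have "V \<in> \<mu>" using step V'(3) by (auto simp: below_def)
        moreover have "V \<subset> ?f ` U" using V' inj[of V' U] UX by auto
        ultimately show "V \<in> below \<mu> (?f ` U)" by (simp add: below_def)
      qed
      then have "rank \<mu> ` below \<mu> (?f ` U) = (\<lambda>V. rank \<mu> (?f ` V)) ` below \<mu> U" by (simp add: image_image)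
      also have "\<dots> = rank \<mu> ` below \<mu> U"
        using less.IH less.prems by (intro image_cong) (auto simp: below_def)
      finally show ?case
        using rank_rec[OF psubset_wf less.hyps] rank_rec[OF psubset_wf, of "?f ` U"] step[OF less.prems] by (auto simp: below_def)
    qed
  qed
  \<comment> \<open>\<open>W = X\<close> is treated separately because \<open>below \<mu> X\<close>
    contains proper subsets only.\<close>
  show "?f ` W \<in> \<mu>" "?f ` W \<subseteq> Y" "rank \<mu> (?f ` W) = rank \<mu> W"
    using W rk[of W] step[of W] bij XY by (cases "W = X"; auto simp: below_def bij_betw_def)+
qed

section \<open>Agreement of members below a common element\<close>

text \<open>For \<open>b\<close> in \<open>X1\<close> this is the first inequality of
  \<open>is_star\<close>; for \<open>b\<close> in \<open>X2 - X1\<close> both inequalities are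
  chained through a point of \<open>X1 - X2\<close>.\<close>

lemma star_initial:
  assumes "X1 \<in> \<mu>" "X2 \<in> \<mu>" "rank \<mu> X1 = rank \<mu> X2" "is_star R X X1 X2"
    and a: "a \<in> X1 \<inter> X2" and b: "b \<in> X1 \<union> X2" "(b, a) \<in> R"
  shows "b \<in> X1 \<inter> X2"
proof (rule ccontr)
  assume nb: "b \<notin> X1 \<inter> X2"
  have "(a, b) \<in> R \<and> a \<noteq> b"
  proof (cases "b \<in> X1")
    case True
    then show ?thesis using assms(4) a nb unfolding is_star_def set_olt_def olt_def by blast
  next
    case False
    \<comment> \<open>If \<open>X1 - X2\<close> were empty, the inequalities would say nothing about
      \<open>X2 - X1\<close>. Members of equal rank are never properly nested.\<close>
    then have "\<not> X1 \<subseteq> X2" using b same_rank_sub[OF assms(1,2)] assms(3) by blast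
    then obtain c where c: "c \<in> X1 - X2" by blast
    then have "olt R a c" "olt R c b"
      using assms(4) a b False unfolding is_star_def set_olt_def by blast+
    then show ?thesis unfolding olt_def using R_trans R_antisym by blast
  qed
  then show False using R_antisym b by blast
qed

text \<open>The isomorphism and the identity of \<open>X2\<close> both map onto \<open>X2\<close>,
  so they agree on the common initial segment of their domains. The disjunction allows either half
  to be the source.\<close>

lemma star_otp_map_fix:
  assumes X: "X1 \<in> \<mu>" "X2 \<in> \<mu>" "rank \<mu> X1 = rank \<mu> X2" and st: "is_star R X X1 X2 \<or> is_star R X X2 X1"
    and a: "a \<in> X1 \<inter> X2"
  shows "otp_map R X2 X1 a = a"
proof -
  have I: "x \<in> X1 \<inter> X2" if "i \<in> X1 \<inter> X2" "x \<in> X1 \<union> X2" "(x, i) \<in> R" for i x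
    using st star_initial[OF X _ that] star_initial[OF X(2,1) X(3)[symmetric], of X i x] that by blast
  have "otp_map R X2 X1 a = id a"
    by (rule iso_agree_on_initial[OF R_Well_order member_sub[OF X(1)] member_sub[OF X(2)] member_sub[OF X(2)]
          otp_map_bij[OF X] bij_betw_id _ order_refl I a]) simp_all
  then show ?thesis by simp
qed

text \<open>Induction on a member \<open>Z\<close> covering \<open>X\<close> and \<open>Y\<close>.
  The substantial case is a split \<open>Z\<close> with \<open>X\<close> and \<open>Y\<close> in
  different halves: the isomorphism between the halves moves \<open>X\<close> into the half of
  \<open>Y\<close> and fixes \<open>a\<close> and \<open>b\<close>, which lie in the common initial
  segment.\<close>

lemma coherence_same_rank:
  assumes "X \<in> \<mu>" "Y \<in> \<mu>" "rank \<mu> X = rank \<mu> Y" "a \<in> X \<inter> Y" "b \<in> X" "(b, a) \<in> R"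
  shows "b \<in> Y"
proof -
  obtain Z where Z: "Z \<in> \<mu>" "X \<union> Y \<subseteq> Z" using members_directed assms by blast
  have "X \<subseteq> Z" "Y \<subseteq> Z" using Z by auto
  with psubset_wf assms show ?thesis
  proof (induction Z arbitrary: X Y rule: wfp_on_induct)
    case in_set
    then show ?case using Z(1) by simp
  next
    case (less Z)
    show ?case
    proof (cases "X = Z \<or> Y = Z")
      case True
      then have "X = Y" using less.prems same_rank_sub by metis
      then show ?thesis using less.prems by simp
    next
      case False
      then have XY: "X \<in> below \<mu> Z" "Y \<in> below \<mu> Z" using less.prems by (auto simp: below_def)
      show ?thesis using less.hyps
      proof (cases rule: member_cases)
        case directed
        then obtain W where "W \<in> below \<mu> Z" "X \<union> Y \<subseteq> W" using XY unfolding directed_family_def by blast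
        then show ?thesis using less.IH[of W X Y] less.prems by (auto simp: below_def)
      next
        case (star X1 X2)
        have "X1 \<in> below \<mu> Z" "X2 \<in> below \<mu> Z" unfolding star(5) by simp_all
        then have sub: "X1 \<subset> Z" "X2 \<subset> Z" by (simp_all add: below_def)
        have mixed: ?thesis
          if V: "V1 \<in> \<mu>" "V2 \<in> \<mu>" "rank \<mu> V1 = rank \<mu> V2" "is_star R Z V1 V2 \<or> is_star R Z V2 V1"
            "V2 \<subset> Z" "X \<subseteq> V1" "Y \<subseteq> V2" for V1 V2 :: "'k set set"
        proof -
          let ?f = "otp_map R V2 V1"
          have a: "a \<in> V1 \<inter> V2" and b1: "b \<in> V1" using V(6,7) less.prems(4,5) by auto
          have b: "b \<in> V1 \<inter> V2"
            using V(4)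
          proof
            assume "is_star R Z V1 V2"
            from star_initial[OF V(1,2,3) this a _ less.prems(6)] b1 show ?thesis by simp
          next
            assume "is_star R Z V2 V1"
            from star_initial[OF V(2,1) V(3)[symmetric] this _ _ less.prems(6)] a b1 show ?thesis by simp
          qed
          have fix_ab: "?f a = a" "?f b = b" using star_otp_map_fix[OF V(1-4)] a b by auto
          have im: "?f ` X \<in> \<mu>" "?f ` X \<subseteq> V2" "rank \<mu> (?f ` X) = rank \<mu> X"
            by (rule otp_map_image[OF V(1-3) less.prems(1) V(6)])+
          have "a \<in> ?f ` X" "b \<in> ?f ` X"
            using less.prems(4,5) fix_ab by (auto intro: rev_image_eqI)
          then show ?thesis
            using less.IH[OF V(2,5) im(1) less.prems(2) _ _ _ less.prems(6) im(2) V(7)] im(3) less.prems(3,4)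
            by simp
        qed
        have "X \<subseteq> X1 \<or> X \<subseteq> X2" "Y \<subseteq> X1 \<or> Y \<subseteq> X2"
          using star_members[OF star(1,2,5)] XY by simp_all
        then consider "X \<subseteq> X1" "Y \<subseteq> X1" | "X \<subseteq> X2" "Y \<subseteq> X2" | "X \<subseteq> X1" "Y \<subseteq> X2" | "X \<subseteq> X2" "Y \<subseteq> X1"
          by metis
        then show ?thesis
        proof cases
          case 1 then show ?thesis by (rule less.IH[OF star(1) sub(1) less.prems(1-6)])
        next
          case 2 then show ?thesis by (rule less.IH[OF star(2) sub(2) less.prems(1-6)])
        next
          case 3 then show ?thesis by (intro mixed[OF star(1,2,3) disjI1[OF star(4)] sub(2)])
        next
          case 4 then show ?thesis by (intro mixed[OF star(2,1) star(3)[symmetric] disjI2[OF star(4)] sub(1)])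
        qed
      qed
    qed
  qed
qed

text \<open>Shrinking \<open>Y\<close> around \<open>a\<close> to the rank of \<open>X\<close>
  reduces this to equal ranks.\<close>

lemma coherence:
  assumes "X \<in> \<mu>" "Y \<in> \<mu>" "X \<preceq> Y" "a \<in> X" "a \<in> Y" "b \<in> X" "(b, a) \<in> R"
  shows "b \<in> Y"
proof -
  obtain Y' where "Y' \<in> \<mu>" "Y' \<subseteq> Y" "a \<in> Y'" "rank \<mu> Y' = rank \<mu> X"
    using descend[OF assms(2,1,3,5)] by blast
  then show ?thesis using coherence_same_rank[of X Y' a b] assms by auto
qed

text \<open>Applied to members of least rank, this yields \<rho>(a, x) \<le> max(\<rho>(a, y),
  \<rho>(y, x)) for a \<le> y. The positions of \<open>x\<close> above and below \<open>y\<close>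
  account for the two ultrametric inequalities.\<close>

lemma ultrametric:
  assumes "Y \<in> \<mu>" "Z \<in> \<mu>" "(a, y) \<in> R" "a \<in> Y" "y \<in> Y" "x \<in> Z" "y \<in> Z"
  shows "\<exists>V\<in>\<mu>. a \<in> V \<and> x \<in> V \<and> (rank \<mu> V = rank \<mu> Y \<or> rank \<mu> V = rank \<mu> Z)"
proof (cases "Y \<preceq> Z")
  case True
  then have "a \<in> Z" using coherence[of Y Z y a] assms by blast
  then show ?thesis using assms by blast
next
  case False
  then have ZY: "Z \<preceq> Y" using rank_le_total assms by blast
  have F: "x \<in> Field R" "y \<in> Field R" using assms member_sub by blast+
  show ?thesis
  proof (cases "(x, y) \<in> R")
    case True
    then have "x \<in> Y" using coherence[OF assms(2,1) ZY, of y x] assms by blast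
    then show ?thesis using assms by blast
  next
    case False
    then have yx: "(y, x) \<in> R" using R_total F by blast
    \<comment> \<open>\<open>Y\<close> may miss \<open>x\<close>, so it is replaced by a member of
      the same rank through \<open>x\<close>; coherence puts first \<open>y\<close>, then
      \<open>a\<close>, into it.\<close>
    obtain V where V: "V \<in> \<mu>" "x \<in> V" "rank \<mu> V = rank \<mu> Y"
      using exists_same_rank[OF assms(1) F(1)] by blast
    have "Z \<preceq> V" using ZY V rank_le_cong by metis
    then have "y \<in> V" using coherence[of Z V x y] V yx assms by blast
    then have "a \<in> V" using coherence[of Y V y a] V rank_eq_le[of Y V] assms by auto
    then show ?thesis using V by blast
  qed
qed

section \<open>Members of least rank\<close>

text \<open>The rank of \<open>least_member {a, b}\<close> is \<rho>(a, b); taking a set as argument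
  builds in the symmetry of \<rho>.\<close>

definition least_member :: "'k set set \<Rightarrow> 'k set set" where
  "least_member s = (SOME X. X \<in> \<mu> \<and> s \<subseteq> X \<and> (\<forall>Y\<in>\<mu>. s \<subseteq> Y \<longrightarrow> X \<preceq> Y))"

lemma least_member:
  assumes "a \<in> Field R" "b \<in> Field R"
  shows "least_member {a, b} \<in> \<mu>" "a \<in> least_member {a, b}" "b \<in> least_member {a, b}"
    and "Y \<in> \<mu> \<Longrightarrow> a \<in> Y \<Longrightarrow> b \<in> Y \<Longrightarrow> least_member {a, b} \<preceq> Y"
proof -
  let ?B = "rank \<mu> ` {X \<in> \<mu>. {a, b} \<subseteq> X}"
  have B: "?B \<subseteq> Field (rank_order \<mu>)" "?B \<noteq> {}"
    using rank_Field exists_member2[OF assms] by auto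
  obtain X where X: "X \<in> \<mu>" "{a, b} \<subseteq> X" "rank \<mu> X = wo_rel.minim (rank_order \<mu>) ?B"
    using wo_rel.minim_in[OF rank_order(3) B] by auto
  have "X \<preceq> Y" if "Y \<in> \<mu>" "{a, b} \<subseteq> Y" for Y
    unfolding rank_le_def X(3) by (rule wo_rel.minim_least[OF rank_order(3) B(1)]) (use that in auto)
  then have "\<exists>X. X \<in> \<mu> \<and> {a, b} \<subseteq> X \<and> (\<forall>Y\<in>\<mu>. {a, b} \<subseteq> Y \<longrightarrow> X \<preceq> Y)" using X by blast
  from someI_ex[OF this, folded least_member_def]
  show "least_member {a, b} \<in> \<mu>" "a \<in> least_member {a, b}" "b \<in> least_member {a, b}"
    "Y \<in> \<mu> \<Longrightarrow> a \<in> Y \<Longrightarrow> b \<in> Y \<Longrightarrow> least_member {a, b} \<preceq> Y" by blast+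
qed

text \<open>Transport moves only members inside the domain of the isomorphism, so a member around a
  pair has to be brought inside \<open>Z\<close> with its rank unchanged: descend at the larger
  element, then recover the smaller one by coherence.\<close>

lemma least_member_inside:
  assumes Z: "Z \<in> \<mu>" and V: "V \<in> \<mu>" "V \<preceq> Z" and ab: "a \<in> V" "b \<in> V" "(a, b) \<in> R" "b \<in> Z"
  shows "\<exists>X\<in>\<mu>. X \<subseteq> Z \<and> a \<in> X \<and> b \<in> X \<and> rank \<mu> X = rank \<mu> V"
proof -
  obtain X where X: "X \<in> \<mu>" "X \<subseteq> Z" "b \<in> X" "rank \<mu> X = rank \<mu> V"
    using descend[OF Z V ab(4)] by blast
  moreover have "a \<in> X" using coherence_same_rank[OF V(1) X(1) X(4)[symmetric], of b a] ab X by blast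
  ultimately show ?thesis by blast
qed

text \<open>Rigidity again: the composition and the identity are automorphisms of \<open>X\<close>,
  compared on the initial segment \<open>I = X\<close>.\<close>

lemma otp_map_inverse:
  assumes X: "X \<in> \<mu>" "Y \<in> \<mu>" "rank \<mu> X = rank \<mu> Y" and a: "a \<in> X"
  shows "otp_map R X Y (otp_map R Y X a) = a"
proof -
  note X' = X(2,1) X(3)[symmetric]
  note b = otp_map_bij(1)[OF X] and b' = otp_map_bij(1)[OF X']
  have "(otp_map R X Y \<circ> otp_map R Y X) a = id a"
  proof (rule iso_agree_on_initial[OF R_Well_order, where f = "otp_map R X Y \<circ> otp_map R Y X" and g = id and X=X and Y=X and Z=X and I=X])
    show "bij_betw (otp_map R X Y \<circ> otp_map R Y X) X X" by (rule bij_betw_trans[OF b b'])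
    show "(a, b) \<in> R \<longleftrightarrow> ((otp_map R X Y \<circ> otp_map R Y X) a, (otp_map R X Y \<circ> otp_map R Y X) b) \<in> R"
      if "a \<in> X" "b \<in> X" for a b
      using otp_map_bij(2)[OF X that] otp_map_bij(2)[OF X' bij_betwE[OF b, rule_format] bij_betwE[OF b, rule_format], OF that]
      by simp
  qed (use member_sub[OF X(1)] a in auto)
  then show ?thesis by simp
qed

lemma least_member_le:
  assumes "V \<in> \<mu>" "a \<in> V" "b \<in> V" shows "least_member {a, b} \<preceq> V"
  using least_member(4)[of a b V] member_sub[OF assms(1)] assms by blast

text \<open>The image of a least-rank member inside \<open>X\<close> has the same rank and contains
  the image pair, so \<rho> does not increase.\<close>

lemma least_member_otp_map:
  assumes X: "X \<in> \<mu>" "Y \<in> \<mu>" "rank \<mu> X = rank \<mu> Y" and ab: "a \<in> X" "b \<in> X" "(a, b) \<in> R"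
  shows "least_member {otp_map R Y X a, otp_map R Y X b} \<preceq> least_member {a, b}"
proof -
  have F: "a \<in> Field R" "b \<in> Field R" using member_sub[OF X(1)] ab by auto
  obtain W where W: "W \<in> \<mu>" "W \<subseteq> X" "a \<in> W" "b \<in> W" "rank \<mu> W = rank \<mu> (least_member {a, b})"
    using least_member_inside[OF X(1) least_member(1)[OF F] least_member_le[OF X(1) ab(1,2)] least_member(2,3)[OF F] ab(3,2)]
    by blast
  note im = otp_map_image[OF X W(1,2)]
  have "least_member {otp_map R Y X a, otp_map R Y X b} \<preceq> otp_map R Y X ` W"
    by (rule least_member_le[OF im(1)]) (use W in auto)
  then show ?thesis using rank_le_cong[OF HOL.refl, of "otp_map R Y X ` W"] im(3) W(5) by simp
qed

section \<open>Finiteness of the exceptional ranks\<close>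

text \<open>Ranks being totally ordered, the negated comparison means \<rho>(a, y) < \<rho>(a, x).
  The definition is not symmetric in \<open>x\<close> and \<open>y\<close>.\<close>

definition trace_ranks :: "'k set \<Rightarrow> 'k set \<Rightarrow> 'k set set set set" where
  "trace_ranks x y = {rank \<mu> (least_member {a, x}) | a.
     a \<in> Field R \<and> olt R a x \<and> olt R a y \<and> \<not> least_member {a, x} \<preceq> least_member {a, y}}"

text \<open>The ultrametric inequality bounds \<rho>(a, x) by the maximum of \<rho>(a, y) and the
  rank of \<open>Z\<close>; the assumption excludes the former.\<close>

lemma trace_bound:
  assumes Z: "Z \<in> \<mu>" "x \<in> Z" "y \<in> Z" and a: "a \<in> Field R" "olt R a y"
    and n: "\<not> least_member {a, x} \<preceq> least_member {a, y}"
  shows "least_member {a, x} \<preceq> Z"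
proof -
  have F: "x \<in> Field R" "y \<in> Field R" using member_sub[OF Z(1)] Z by auto
  obtain V where V: "V \<in> \<mu>" "a \<in> V" "x \<in> V"
    "rank \<mu> V = rank \<mu> (least_member {a, y}) \<or> rank \<mu> V = rank \<mu> Z"
    using ultrametric[OF least_member(1)[OF a(1) F(2)] Z(1) _ least_member(2,3)[OF a(1) F(2)] Z(2,3)] a(2)
    unfolding olt_def by blast
  show ?thesis
    using least_member_le[OF V(1-3)] V(4) n unfolding rank_le_def by auto
qed

text \<open>Every member below \<open>Z\<close> lies in a half, so the rank of \<open>Z\<close> is
  the immediate successor of the common rank of the halves.\<close>

lemma star_rank:
  assumes X: "X1 \<in> \<mu>" "X2 \<in> \<mu>" "rank \<mu> X1 = rank \<mu> X2"
    and Z: "Z \<in> \<mu>" "below \<mu> Z = below \<mu> X1 \<union> below \<mu> X2 \<union> {X1, X2}"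
    and V: "V \<in> \<mu>" "\<not> Z \<preceq> V"
  shows "V \<preceq> X2"
proof (rule ccontr)
  assume n: "\<not> V \<preceq> X2"
  have "\<not> V \<preceq> W" if "W \<in> below \<mu> Z" for W
  proof -
    have "W \<preceq> X1 \<or> W \<preceq> X2"
      using star_members[OF X(1,2) Z(2) that] rank_mono X by metis
    then have "W \<preceq> X2" using X(3) unfolding rank_le_def by simp
    then show ?thesis using n rank_le_trans by metis
  qed
  then show False using rank_least[OF Z(1) V(1)] V(2) by metis
qed

text \<open>Induction on a member containing both points. If a splitting separates them, the
  isomorphism \<open>?g\<close> from \<open>X2\<close> onto \<open>X1\<close> brings the point of
  \<open>X2\<close> into \<open>X1\<close>; it leaves \<rho>(a, z) unchanged for \<open>a\<close> in
  the common part below \<open>z\<close>.\<close>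

lemma finite_trace_ranks:
  assumes "Z \<in> \<mu>" "x \<in> Z" "y \<in> Z"
  shows "finite (trace_ranks x y)"
  using psubset_wf assms(2,3)
proof (induction Z arbitrary: x y rule: wfp_on_induct)
  case in_set
  show ?case by (rule assms(1))
next
  case (less Z)
  have F: "x \<in> Field R" "y \<in> Field R" using member_sub[OF less.hyps] less.prems by auto
  show ?case using less.hyps
  proof (cases rule: member_cases)
    case directed
    show ?thesis
    proof (cases "zero_rank \<mu> Z")
      case True
      \<comment> \<open>Rank zero is minimal, whereas a value in the set would give \<rho>(a, y) <
        \<rho>(a, x) with \<rho>(a, x) at most the rank of \<open>Z\<close>.\<close>
      have "Z \<preceq> V" if "V \<in> \<mu>" for V
      proof (rule ccontr)
        assume n: "\<not> Z \<preceq> V"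
        then have "V \<preceq> Z" using rank_le_total that less.hyps by blast
        then have "rank \<mu> V \<in> underS (rank_order \<mu>) (rank \<mu> Z)"
          using n unfolding underS_def rank_le_def by auto
        then show False using True unfolding zero_rank_def by simp
      qed
      then have "least_member {a, x} \<preceq> least_member {a, y}"
        if "a \<in> Field R" "olt R a y" for a
        using trace_bound[OF less.hyps less.prems that] rank_le_trans least_member(1)[OF that(1) F(2)] by metis
      then have "trace_ranks x y = {}"
        unfolding trace_ranks_def by simp
      then show ?thesis by simp
    next
      case False
      then have "Z = \<Union>(below \<mu> Z)" by (rule nonzero_rank[OF less.hyps])
      then obtain U V where "U \<in> below \<mu> Z" "V \<in> below \<mu> Z" "x \<in> U" "y \<in> V"
        using less.prems by blast
      then obtain W where "W \<in> below \<mu> Z" "x \<in> W" "y \<in> W"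
        using directed unfolding directed_family_def by blast
      then show ?thesis using less.IH[of W x y] by (simp add: below_def)
    qed
  next
    case (star X1 X2)
    have "X1 \<in> below \<mu> Z" "X2 \<in> below \<mu> Z" unfolding star(5) by simp_all
    then have sub: "X1 \<subset> Z" "X2 \<subset> Z" by (simp_all add: below_def)
    have X: "X2 \<in> \<mu>" "X1 \<in> \<mu>" "rank \<mu> X2 = rank \<mu> X1" using star by auto
    let ?g = "otp_map R X1 X2"
    have le2: "V \<preceq> X2" if "V \<in> \<mu>" "\<not> Z \<preceq> V" for V
      by (rule star_rank[OF star(1-3) less.hyps star(5) that])
    \<comment> \<open>This forces the parameter \<open>a\<close> into the common part, where
      \<open>?g\<close> is the identity.\<close>
    have gap: "a \<in> X1 \<inter> X2" if "a \<in> X2" "olt R a z" "z \<in> X1 - X2" for a z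
    proof (rule ccontr)
      assume "a \<notin> X1 \<inter> X2"
      then have "olt R z a" using star(4) that unfolding is_star_def set_olt_def by blast
      then show False using that(2) R_antisym unfolding olt_def by blast
    qed
    have fix_g: "?g a = a" if "a \<in> X1 \<inter> X2" for a
      using star_otp_map_fix[OF X, of Z a] star(4) that by blast
    have g_in: "?g z \<in> X1" if "z \<in> X2" for z
      using bij_betwE[OF otp_map_bij(1)[OF X]] that by blast
    have olt_g: "olt R a (?g z)" if "a \<in> X1 \<inter> X2" "z \<in> X2" "olt R a z" for a z
    proof -
      have aX: "a \<in> X2" using that by simp
      have "(a, ?g z) \<in> R" using otp_map_bij(2)[OF X aX that(2)] that(3) fix_g[OF that(1)] unfolding olt_def by simp
      moreover have "a \<noteq> ?g z"
        using otp_map_bij(1)[OF X] aX that fix_g[OF that(1)] unfolding bij_betw_def inj_on_def olt_def by metis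
      ultimately show ?thesis unfolding olt_def by simp
    qed
    have le_g: "least_member {a, ?g z} \<preceq> least_member {a, z}" if "a \<in> X1 \<inter> X2" "z \<in> X2" "olt R a z" for a z
      using least_member_otp_map[OF X, of a z] that fix_g[OF that(1)] unfolding olt_def by simp
    \<comment> \<open>The reverse inequality comes from the inverse isomorphism, which sends
      \<open>?g z\<close> back to \<open>z\<close> and also fixes \<open>a\<close>.\<close>
    have ge_g: "least_member {a, z} \<preceq> least_member {a, ?g z}" if "a \<in> X1 \<inter> X2" "z \<in> X2" "olt R a z" for a z
    proof -
      have "otp_map R X2 X1 a = a" using star_otp_map_fix[OF star(1-3), of Z a] star(4) that by blast
      moreover have "otp_map R X2 X1 (?g z) = z" by (rule otp_map_inverse[OF X that(2)])
      moreover have "(a, ?g z) \<in> R" using olt_g[OF that] by (simp add: olt_def)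
      ultimately show ?thesis
        using least_member_otp_map[OF star(1-3), of a "?g z"] g_in that by simp
    qed
    consider "x \<in> X1" "y \<in> X1" | "x \<in> X2" "y \<in> X2" | "x \<in> X1 - X2" "y \<in> X2" | "x \<in> X2" "y \<in> X1 - X2"
      using star(4) less.prems unfolding is_star_def by blast
    then show ?thesis
    proof cases
      case 1 then show ?thesis by (rule less.IH[OF star(1) sub(1)])
    next
      case 2 then show ?thesis by (rule less.IH[OF star(2) sub(2)])
    next
      \<comment> \<open>The strictly smaller value \<rho>(a, y) is below the rank of
        \<open>Z\<close>, hence at most that of \<open>X2\<close>. Coherence at \<open>y\<close>
        puts \<open>a\<close> into \<open>X2\<close>, so no value is lost when \<open>?g y\<close>
        replaces \<open>y\<close>.\<close>
      case 3
      have "trace_ranks x y \<subseteq> trace_ranks x (?g y)"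
      proof
        fix r assume "r \<in> trace_ranks x y"
        then obtain a where a: "r = rank \<mu> (least_member {a, x})" "a \<in> Field R" "olt R a x" "olt R a y"
          "\<not> least_member {a, x} \<preceq> least_member {a, y}" unfolding trace_ranks_def by blast
        note M = least_member[OF a(2) F(2)]
        have "least_member {a, x} \<preceq> Z" by (rule trace_bound[OF less.hyps less.prems a(2,4,5)])
        then have "\<not> Z \<preceq> least_member {a, y}" using a(5) rank_le_trans by metis
        then have "least_member {a, y} \<preceq> X2" by (rule le2[OF M(1)])
        then have "a \<in> X2" using coherence[OF M(1) star(2) _ M(3) 3(2) M(2)] a(4) by (simp add: olt_def)
        then have ai: "a \<in> X1 \<inter> X2" using gap a(3) 3(1) by metis
        have "\<not> least_member {a, x} \<preceq> least_member {a, ?g y}"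
          using le_g[OF ai 3(2) a(4)] a(5) rank_le_trans by metis
        then show "r \<in> trace_ranks x (?g y)"
          unfolding trace_ranks_def using a(1,2,3) olt_g[OF ai 3(2) a(4)] by blast
      qed
      moreover have "finite (trace_ranks x (?g y))"
        using less.IH[OF star(1) sub(1)] 3 g_in by simp
      ultimately show ?thesis by (rule finite_subset)
    next
      \<comment> \<open>Here coherence at \<open>x\<close> locates \<open>a\<close> only if
        \<rho>(a, x) is below the rank of \<open>Z\<close>. The value equal to that rank gives no
        such information and is the one extra element.\<close>
      case 4
      have "trace_ranks x y \<subseteq> insert (rank \<mu> Z) (trace_ranks (?g x) y)"
      proof
        fix r assume "r \<in> trace_ranks x y"
        then obtain a where a: "r = rank \<mu> (least_member {a, x})" "a \<in> Field R" "olt R a x" "olt R a y"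
          "\<not> least_member {a, x} \<preceq> least_member {a, y}" unfolding trace_ranks_def by blast
        note M = least_member[OF a(2) F(1)]
        have MZ: "least_member {a, x} \<preceq> Z" by (rule trace_bound[OF less.hyps less.prems a(2,4,5)])
        show "r \<in> insert (rank \<mu> Z) (trace_ranks (?g x) y)"
        proof (cases "Z \<preceq> least_member {a, x}")
          case True
          then show ?thesis using rank_le_antisym[OF MZ] a(1) by simp
        next
          case False
          then have "least_member {a, x} \<preceq> X2" by (rule le2[OF M(1)])
          then have "a \<in> X2" using coherence[OF M(1) star(2) _ M(3) 4(1) M(2)] a(3) by (simp add: olt_def)
          then have ai: "a \<in> X1 \<inter> X2" using gap a(4) 4(2) by metis
          have eq: "rank \<mu> (least_member {a, x}) = rank \<mu> (least_member {a, ?g x})"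
            by (rule rank_le_antisym[OF ge_g[OF ai 4(1) a(3)] le_g[OF ai 4(1) a(3)]])
          then have "\<not> least_member {a, ?g x} \<preceq> least_member {a, y}"
            using a(5) unfolding rank_le_def by simp
          then have "rank \<mu> (least_member {a, ?g x}) \<in> trace_ranks (?g x) y"
            unfolding trace_ranks_def using a(2,4) olt_g[OF ai 4(1) a(3)] by blast
          then show ?thesis using a(1) eq by simp
        qed
      qed
      moreover have "finite (insert (rank \<mu> Z) (trace_ranks (?g x) y))"
        using less.IH[OF star(1) sub(1), of "?g x" y] 4 g_in by simp
      ultimately show ?thesis by (rule finite_subset)
    qed
  qed
qed

text \<open>
  Without a bound, the segment below some \<open>a\<close> with \<open>\<kappa>\<close> predecessors would be covered by fewer than
  \<open>\<kappa>\<close> members of \<open>\<mu>\<close>.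
\<close>

lemma exists_rank_bound:
  assumes S: "S \<subseteq> \<mu>" "|S| <o \<kappa>"
  shows "\<exists>Z\<in>\<mu>. \<forall>W\<in>S. W \<preceq> Z"
proof (rule ccontr)
  assume no: "\<not> ?thesis"
  have Wk: "Well_order \<kappa>" using kappa_Cinfinite card_order_on_well_order_on by blast
  have "\<kappa> <o R" using kappa_Cinfinite by (intro cardSuc_greater) simp
  then obtain a where a: "a \<in> Field R" "\<kappa> =o Restr R (underS R a)"
    using ordLess_iff_ordIso_Restr[OF R_Well_order Wk] by blast
  have us: "underS R a \<subseteq> Field R" by (auto simp: underS_def Field_def)
  have "Field (Restr R (underS R a)) = underS R a"
    by (rule Refl_Field_Restr2[OF wo_rel.REFL[OF R_wo_rel] us])
  then have eq: "|Field \<kappa>| =o |underS R a|" using card_of_cong[OF a(2)] by simp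
  \<comment> \<open>\<open>V W\<close> is a copy of \<open>W\<close> through \<open>a\<close>. For
    \<open>b\<close> below \<open>a\<close>, some \<open>W\<close> in \<open>S\<close> has rank
    above that of a member containing \<open>a\<close> and \<open>b\<close>, and coherence at
    \<open>a\<close> puts \<open>b\<close> into \<open>V W\<close>.\<close>
  have "\<forall>W\<in>S. \<exists>V\<in>\<mu>. a \<in> V \<and> rank \<mu> V = rank \<mu> W" using exists_same_rank a(1) S(1) by blast
  then obtain V where V: "\<And>W. W \<in> S \<Longrightarrow> V W \<in> \<mu> \<and> a \<in> V W \<and> rank \<mu> (V W) = rank \<mu> W" by metis
  have "underS R a \<subseteq> (\<Union>W\<in>S. V W)"
  proof
    fix b assume b: "b \<in> underS R a"
    then obtain Z where Z: "Z \<in> \<mu>" "a \<in> Z" "b \<in> Z" using exists_member2 a(1) us by blast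
    then obtain W where W: "W \<in> S" "\<not> W \<preceq> Z" using no by blast
    then have "Z \<preceq> W" using rank_le_total[of W Z] Z(1) S(1) by blast
    then have "Z \<preceq> V W" using V[OF W(1)] unfolding rank_le_def by simp
    then have "b \<in> V W" using coherence[of Z "V W" a b] V[OF W(1)] Z b unfolding underS_def by simp
    then show "b \<in> (\<Union>W\<in>S. V W)" using W(1) by blast
  qed
  then have "|underS R a| \<le>o |\<Union>W\<in>S. V W|" by (rule card_of_mono1)
  also have "|\<Union>W\<in>S. V W| <o \<kappa>"
    by (rule regularCard_UNION_bound[OF kappa_Cinfinite kappa_regular S(2)]) (use V member_small in blast)
  finally have "|Field \<kappa>| <o \<kappa>" using eq ordIso_ordLess_trans by blast
  moreover have "|Field \<kappa>| =o \<kappa>" using kappa_Cinfinite card_of_Field_ordIso by blast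
  ultimately show False using not_ordLess_ordIso by blast
qed

end

section \<open>Thinning out\<close>

locale Delta_setting = two_cardinal_family "cardSuc lam" \<mu> for lam :: "'a rel" and \<mu> +
  assumes lam: "Cinfinite lam" "regularCard lam" "weak_power lam =o lam"
begin

lemma lam_card: "Card_order lam" "\<not> finite (Field lam)"
  using lam(1) by (auto simp: cinfinite_def)

lemma less_Suc_iff: "|B| <o cardSuc lam \<longleftrightarrow> |B| \<le>o lam"
  by (rule cardSuc_ordLeq_ordLess[OF lam_card(1) card_of_Card_order])

lemma finite_small: "finite B \<Longrightarrow> |B| <o lam"
  using finite_iff_ordLess_natLeq natLeq_ordLeq_cinfinite[OF lam(1)] ordLess_ordLeq_trans by blast

text \<open>The successive thinnings \<open>J1\<close>, \<open>J2\<close>, \<open>J3\<close>,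
  \<open>A\<close> give a \<Delta>-system of rank sets, a constant set of colours, a \<Delta>-system
  of predecessor sets, and a constant trace on the root of the latter.\<close>

lemma thinning:
  assumes "\<forall>\<xi>\<in>Field (cardSuc lam). a \<xi> \<subseteq> Field R \<and> |a \<xi>| <o lam"
  shows "\<exists>A \<subseteq> Field (cardSuc lam). |A| =o cardSuc lam \<and>
    (\<forall>\<xi>\<in>A. \<forall>\<xi>'\<in>A. \<xi> \<noteq> \<xi>' \<longrightarrow>
      (\<forall>\<tau> \<in> a \<xi> \<inter> a \<xi>'. \<forall>\<alpha> \<in> a \<xi> - a \<xi>'. \<forall>\<beta> \<in> a \<xi>' - a \<xi>. olt R \<alpha> \<beta> \<longrightarrow> olt R \<tau> \<beta> \<longrightarrow>
        least_member {\<tau>, \<alpha>} \<preceq> least_member {\<alpha>, \<beta>}))"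
proof -
  let ?\<kappa> = "cardSuc lam"
  note a = bspec[OF assms]
  note Un = regularCard_UNION_bound[OF lam(1,2)]
  have I: "|Field ?\<kappa>| =o ?\<kappa>" using kappa_Cinfinite card_of_Field_ordIso by blast
  define W where "W \<xi> = (\<Union>x\<in>a \<xi>. \<Union>y\<in>a \<xi>. insert (rank \<mu> (least_member {x, y})) (trace_ranks x y))" for \<xi>
  have W_small: "|W \<xi>| <o lam" if \<xi>: "\<xi> \<in> Field ?\<kappa>" for \<xi>
    unfolding W_def
  proof (intro Un)
    fix x y assume "x \<in> a \<xi>" "y \<in> a \<xi>"
    then obtain Z where "Z \<in> \<mu>" "x \<in> Z" "y \<in> Z" using exists_member2 a[OF \<xi>] by blast
    then show "|insert (rank \<mu> (least_member {x, y})) (trace_ranks x y)| <o lam"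
      using finite_trace_ranks by (intro finite_small) simp
  qed (use a[OF \<xi>] in auto)
  obtain J1 r where J1: "J1 \<subseteq> Field ?\<kappa>" "|J1| =o ?\<kappa>" "|r| <o lam" "\<forall>\<xi>\<in>J1. r \<subseteq> W \<xi>"
    "\<forall>\<xi>\<in>J1. \<forall>\<xi>'\<in>J1. \<xi> \<noteq> \<xi>' \<longrightarrow> W \<xi> \<inter> W \<xi>' = r"
    using Delta_system[OF lam I, of W, OF W_small] by metis
  have nonempty: "J \<noteq> {}" if "|J| =o ?\<kappa>" for J :: "'a set set"
  proof
    assume "J = {}"
    then have "|J| \<le>o lam" using finite_small[of J] ordLess_imp_ordLeq by blast
    then show False using not_large[OF lam(1) that] by blast
  qed
  obtain \<xi>1 where \<xi>1: "\<xi>1 \<in> J1" using nonempty[OF J1(2)] by blast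
  have "\<exists>V\<in>\<mu>. rank \<mu> V = v" if v: "v \<in> r" for v
  proof -
    have "v \<in> W \<xi>1" using v \<xi>1 J1(4) by blast
    then obtain x y where xy: "x \<in> a \<xi>1" "y \<in> a \<xi>1" "v = rank \<mu> (least_member {x, y}) \<or> v \<in> trace_ranks x y"
      unfolding W_def by blast
    have F: "x \<in> Field R" "y \<in> Field R" using a[of \<xi>1] xy \<xi>1 J1(1) by blast+
    from xy(3) show ?thesis
    proof
      assume "v = rank \<mu> (least_member {x, y})"
      then show ?thesis using least_member(1)[OF F] by blast
    next
      assume "v \<in> trace_ranks x y"
      then obtain p where "p \<in> Field R" "v = rank \<mu> (least_member {p, x})" unfolding trace_ranks_def by blast
      then show ?thesis using least_member(1)[OF _ F(1)] by blast
    qed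
  qed
  then obtain V where V: "\<And>v. v \<in> r \<Longrightarrow> V v \<in> \<mu> \<and> rank \<mu> (V v) = v" by metis
  have "|V ` r| \<le>o lam" using card_of_image[of V r] J1(3) ordLeq_ordLess_trans ordLess_imp_ordLeq by blast
  then have "|V ` r| <o ?\<kappa>" by (simp add: less_Suc_iff)
  \<comment> \<open>The rank of \<open>Z\<close> is the bound \<delta>, and \<open>Z\<close> itself
    is the fixed set of colours.\<close>
  then obtain Z where Z: "Z \<in> \<mu>" "\<And>v. v \<in> r \<Longrightarrow> V v \<preceq> Z" using exists_rank_bound[of "V ` r"] V by blast
  have "\<forall>\<alpha>\<in>Field R. \<exists>X\<in>\<mu>. \<alpha> \<in> X \<and> rank \<mu> X = rank \<mu> Z" using exists_same_rank[OF Z(1)] by blast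
  then obtain X where X: "\<And>\<alpha>. \<alpha> \<in> Field R \<Longrightarrow> X \<alpha> \<in> \<mu> \<and> \<alpha> \<in> X \<alpha> \<and> rank \<mu> (X \<alpha>) = rank \<mu> Z" by metis
  let ?f = "\<lambda>\<alpha>. otp_map R Z (X \<alpha>)"
  define c where "c \<alpha> = ?f \<alpha> \<alpha>" for \<alpha>
  have f_bij: "bij_betw (?f \<alpha>) (X \<alpha>) Z" if "\<alpha> \<in> Field R" for \<alpha>
    using X[OF that] Z(1) by (intro otp_map_bij(1)) auto
  have f_mono: "(x, y) \<in> R \<longleftrightarrow> (?f \<alpha> x, ?f \<alpha> y) \<in> R" if "\<alpha> \<in> Field R" "x \<in> X \<alpha>" "y \<in> X \<alpha>" for \<alpha> x y
    using X[OF that(1)] Z(1) that by (intro otp_map_bij(2)) auto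
  \<comment> \<open>By coherence \<open>X \<alpha>\<close> and \<open>X \<beta>\<close> coincide up
    to \<alpha>, so their isomorphisms onto \<open>Z\<close> agree there: the colour does not depend
    on the member used.\<close>
  have c_agree: "?f \<beta> \<alpha> = c \<alpha>" if "\<alpha> \<in> Field R" "\<beta> \<in> Field R" "\<alpha> \<in> X \<beta>" for \<alpha> \<beta>
    unfolding c_def
  proof (rule iso_agree_on_initial[OF R_Well_order member_sub member_sub member_sub
        f_bij[OF that(2)] f_mono[OF that(2)] f_bij[OF that(1)] f_mono[OF that(1)], where I = "{i \<in> X \<alpha>. (i, \<alpha>) \<in> R}"])
    show "X \<beta> \<in> \<mu>" "X \<alpha> \<in> \<mu>" "Z \<in> \<mu>" using X that Z(1) by auto
    have ab: "x \<in> X \<alpha>" if "x \<in> X \<beta>" "(x, \<alpha>) \<in> R" for x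
      using coherence_same_rank[of "X \<beta>" "X \<alpha>" \<alpha> x] X \<open>\<alpha> \<in> Field R\<close> \<open>\<beta> \<in> Field R\<close> \<open>\<alpha> \<in> X \<beta>\<close> that by simp
    have ba: "x \<in> X \<beta>" if "x \<in> X \<alpha>" "(x, \<alpha>) \<in> R" for x
      using coherence_same_rank[of "X \<alpha>" "X \<beta>" \<alpha> x] X \<open>\<alpha> \<in> Field R\<close> \<open>\<beta> \<in> Field R\<close> \<open>\<alpha> \<in> X \<beta>\<close> that by simp
    show "{i \<in> X \<alpha>. (i, \<alpha>) \<in> R} \<subseteq> X \<beta> \<inter> X \<alpha>" using ba by blast
    show "x \<in> {i \<in> X \<alpha>. (i, \<alpha>) \<in> R}"
      if "i \<in> {i \<in> X \<alpha>. (i, \<alpha>) \<in> R}" "x \<in> X \<beta> \<union> X \<alpha>" "(x, i) \<in> R" for i x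
    proof -
      have "(x, \<alpha>) \<in> R" using R_trans[OF that(3)] that(1) by simp
      then show ?thesis using that(2) ab by blast
    qed
    show "\<alpha> \<in> {i \<in> X \<alpha>. (i, \<alpha>) \<in> R}" using X[OF that(1)] R_refl[OF that(1)] by simp
  qed
  have c_Z: "c \<alpha> \<in> Z" if "\<alpha> \<in> Field R" for \<alpha>
    unfolding c_def using bij_betwE[OF f_bij[OF that]] X[OF that] by blast
  have c_small: "|c ` a \<xi>| <o lam" if "\<xi> \<in> Field ?\<kappa>" for \<xi>
    using card_of_image[of c "a \<xi>"] a[OF that] ordLeq_ordLess_trans by blast
  have "c ` a \<xi> \<subseteq> Z \<and> |c ` a \<xi>| <o lam" if "\<xi> \<in> J1" for \<xi>
  proof -
    have "\<xi> \<in> Field ?\<kappa>" using that J1(1) by blast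
    then show ?thesis using a c_Z c_small by blast
  qed
  then have "(\<lambda>\<xi>. c ` a \<xi>) ` J1 \<subseteq> {x. x \<subseteq> Z \<and> |x| <o lam}" by blast
  moreover have "|Z| \<le>o lam" using member_small[OF Z(1)] by (simp add: less_Suc_iff)
  ultimately have "|(\<lambda>\<xi>. c ` a \<xi>) ` J1| \<le>o lam"
    by (rule ordLeq_transitive[OF card_of_mono1 card_of_small_subsets[OF lam(1,3)]])
  from large_fibre[OF lam(1) J1(2) this] obtain J2 C
    where J2: "J2 \<subseteq> J1" "|J2| =o ?\<kappa>" "\<forall>\<xi>\<in>J2. c ` a \<xi> = C" by blast
  have J2F: "J2 \<subseteq> Field ?\<kappa>" using J2(1) J1(1) by blast
  obtain \<xi>2 where \<xi>2: "\<xi>2 \<in> J2" using nonempty[OF J2(2)] by blast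
  have C_small: "|C| <o lam" using c_small[of \<xi>2] J2(3) \<xi>2 J2F by auto
  \<comment> \<open>For \<xi> in \<open>J2\<close> this contains \<open>a \<xi>\<close> and, for
    each \<beta> in it, every element of \<open>X \<beta>\<close> whose colour is in
    \<open>C\<close>. Each \<beta> contributes at most |C| elements because
    \<open>?f \<beta>\<close> is injective.\<close>
  define P where "P \<xi> = (\<Union>\<beta>\<in>a \<xi>. {p \<in> X \<beta>. ?f \<beta> p \<in> C})" for \<xi>
  have P_small: "|P \<xi>| <o lam" if "\<xi> \<in> J2" for \<xi>
    unfolding P_def
  proof (intro Un)
    have \<xi>F: "\<xi> \<in> Field ?\<kappa>" using that J2F by blast
    show "|a \<xi>| <o lam" using a[OF \<xi>F] by simp
    fix \<beta> assume "\<beta> \<in> a \<xi>"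
    then have "\<beta> \<in> Field R" using a[OF \<xi>F] by blast
    then have "inj_on (?f \<beta>) {p \<in> X \<beta>. ?f \<beta> p \<in> C}"
      using f_bij unfolding bij_betw_def by (metis (no_types, lifting) inj_on_subset mem_Collect_eq subsetI)
    moreover have "?f \<beta> ` {p \<in> X \<beta>. ?f \<beta> p \<in> C} \<subseteq> C" by blast
    ultimately have "|{p \<in> X \<beta>. ?f \<beta> p \<in> C}| \<le>o |C|" unfolding card_of_ordLeq[symmetric] by blast
    then show "|{p \<in> X \<beta>. ?f \<beta> p \<in> C}| <o lam" using C_small ordLeq_ordLess_trans by blast
  qed
  obtain J3 b where J3: "J3 \<subseteq> J2" "|J3| =o ?\<kappa>" "|b| <o lam"
    "\<forall>\<xi>\<in>J3. \<forall>\<xi>'\<in>J3. \<xi> \<noteq> \<xi>' \<longrightarrow> P \<xi> \<inter> P \<xi>' = b"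
    using Delta_system[OF lam J2(2), of P, OF P_small] by metis
  have J3F: "J3 \<subseteq> Field ?\<kappa>" using J3(1) J2F by blast
  have "(\<lambda>\<xi>. a \<xi> \<inter> b) ` J3 \<subseteq> {x. x \<subseteq> b \<and> |x| <o lam}"
    using card_of_mono1[OF Int_lower2] J3(3) ordLeq_ordLess_trans by blast
  moreover have "|b| \<le>o lam" using J3(3) by (rule ordLess_imp_ordLeq)
  ultimately have "|(\<lambda>\<xi>. a \<xi> \<inter> b) ` J3| \<le>o lam"
    by (rule ordLeq_transitive[OF card_of_mono1 card_of_small_subsets[OF lam(1,3)]])
  \<comment> \<open>With a constant trace on \<open>b\<close>, an element of \<open>a \<xi>\<close>
    in \<open>b\<close> belongs to every other \<open>a \<xi>'\<close>; this gives the final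
    contradiction.\<close>
  from large_fibre[OF lam(1) J3(2) this] obtain A e
    where A: "A \<subseteq> J3" "|A| =o ?\<kappa>" "\<forall>\<xi>\<in>A. a \<xi> \<inter> b = e" by blast
  have "least_member {\<tau>, \<alpha>} \<preceq> least_member {\<alpha>, \<beta>}"
    if \<xi>: "\<xi> \<in> A" "\<xi>' \<in> A" "\<xi> \<noteq> \<xi>'" and \<tau>: "\<tau> \<in> a \<xi>" "\<tau> \<in> a \<xi>'" and \<alpha>: "\<alpha> \<in> a \<xi>" "\<alpha> \<notin> a \<xi>'"
      and \<beta>: "\<beta> \<in> a \<xi>'" "\<beta> \<notin> a \<xi>" and olt: "olt R \<alpha> \<beta>" "olt R \<tau> \<beta>" for \<xi> \<xi>' \<tau> \<alpha> \<beta>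
  proof (rule ccontr)
    assume n: "\<not> least_member {\<tau>, \<alpha>} \<preceq> least_member {\<alpha>, \<beta>}"
    have J: "\<xi> \<in> J1" "\<xi>' \<in> J1" "\<xi> \<in> J2" "\<xi>' \<in> J2" "\<xi> \<in> J3" "\<xi>' \<in> J3" "\<xi> \<in> Field ?\<kappa>" "\<xi>' \<in> Field ?\<kappa>"
      using \<xi>(1,2) A(1) J3(1) J2(1) J1(1) by auto
    have F: "\<tau> \<in> Field R" "\<alpha> \<in> Field R" "\<beta> \<in> Field R" using a[OF J(7)] a[OF J(8)] \<tau> \<alpha> \<beta> by auto
    note M\<tau>\<alpha> = least_member[OF F(1,2)] and M\<tau>\<beta> = least_member[OF F(1,3)] and M\<alpha>\<beta> = least_member[OF F(2,3)]
    have le: "least_member {\<alpha>, \<beta>} \<preceq> least_member {\<tau>, \<alpha>}" using n rank_le_total M\<tau>\<alpha>(1) M\<alpha>\<beta>(1) by blast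
    \<comment> \<open>Since \<alpha> is not in \<open>a \<xi>'\<close>, the value has to be
      recovered from \<tau> and \<beta>.\<close>
    have "rank \<mu> (least_member {\<tau>, \<alpha>}) \<in> W \<xi>'"
    proof (cases "(\<tau>, \<alpha>) \<in> R")
      \<comment> \<open>Two instances of \<open>ultrametric\<close> and the assumed failure give
        \<rho>(\<tau>, \<alpha>) = \<rho>(\<tau>, \<beta>).\<close>
      case True
      have \<tau>\<beta>: "(\<tau>, \<beta>) \<in> R" using olt(2) by (simp add: olt_def)
      obtain V1 where V1: "V1 \<in> \<mu>" "\<tau> \<in> V1" "\<alpha> \<in> V1"
        "rank \<mu> V1 = rank \<mu> (least_member {\<tau>, \<beta>}) \<or> rank \<mu> V1 = rank \<mu> (least_member {\<alpha>, \<beta>})"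
        using ultrametric[OF M\<tau>\<beta>(1) M\<alpha>\<beta>(1) \<tau>\<beta> M\<tau>\<beta>(2,3) M\<alpha>\<beta>(2,3)] by blast
      have 1: "least_member {\<tau>, \<alpha>} \<preceq> least_member {\<tau>, \<beta>}"
        using least_member_le[OF V1(1-3)] V1(4) n unfolding rank_le_def by auto
      obtain V2 where V2: "V2 \<in> \<mu>" "\<tau> \<in> V2" "\<beta> \<in> V2"
        "rank \<mu> V2 = rank \<mu> (least_member {\<tau>, \<alpha>}) \<or> rank \<mu> V2 = rank \<mu> (least_member {\<alpha>, \<beta>})"
        using ultrametric[OF M\<tau>\<alpha>(1) M\<alpha>\<beta>(1) True M\<tau>\<alpha>(2,3) M\<alpha>\<beta>(3,2)] by blast
      have "V2 \<preceq> least_member {\<tau>, \<alpha>}"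
        using V2(4) le rank_le_refl[OF M\<tau>\<alpha>(1)] unfolding rank_le_def by auto
      then have 2: "least_member {\<tau>, \<beta>} \<preceq> least_member {\<tau>, \<alpha>}"
        using least_member_le[OF V2(1-3)] rank_le_trans by metis
      show ?thesis using rank_le_antisym[OF 1 2] \<tau>(2) \<beta>(1) unfolding W_def by auto
    next
      \<comment> \<open>With \<alpha> < \<tau>, the failed inequality makes \<alpha> a witness for a
        value in \<open>trace_ranks \<tau> \<beta>\<close>.\<close>
      case False
      then have "olt R \<alpha> \<tau>" using R_total[OF F(1,2)] \<tau>(2) \<alpha>(2) unfolding olt_def by auto
      then have "rank \<mu> (least_member {\<alpha>, \<tau>}) \<in> trace_ranks \<tau> \<beta>"
        unfolding trace_ranks_def using F(2) olt(1) n by (auto simp: insert_commute)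
      then show ?thesis using \<tau>(2) \<beta>(1) unfolding W_def by (auto simp: insert_commute)
    qed
    moreover have "rank \<mu> (least_member {\<tau>, \<alpha>}) \<in> W \<xi>" using \<tau>(1) \<alpha>(1) unfolding W_def by auto
    ultimately have r: "rank \<mu> (least_member {\<tau>, \<alpha>}) \<in> r" using J1(5) J(1,2) \<xi>(3) by blast
    \<comment> \<open>Now \<rho>(\<alpha>, \<beta>) \<le> \<rho>(\<tau>, \<alpha>) \<le> \<delta>,
      which puts \<alpha> into \<open>X \<beta>\<close> and hence into both \<open>P \<xi>\<close>
      and \<open>P \<xi>'\<close>.\<close>
    have "least_member {\<tau>, \<alpha>} \<preceq> Z"
      using Z(2)[OF r] V[OF r] unfolding rank_le_def by simp
    with le have "least_member {\<alpha>, \<beta>} \<preceq> Z" by (rule rank_le_trans)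
    then have "least_member {\<alpha>, \<beta>} \<preceq> X \<beta>" using X[OF F(3)] unfolding rank_le_def by simp
    then have \<alpha>X: "\<alpha> \<in> X \<beta>"
      using coherence[OF M\<alpha>\<beta>(1) _ _ M\<alpha>\<beta>(3) _ M\<alpha>\<beta>(2)] X[OF F(3)] olt(1) by (simp add: olt_def)
    have cC: "c \<alpha> \<in> C" using J2(3) J(3) \<alpha>(1) by blast
    have "\<alpha> \<in> P \<xi>'" unfolding P_def using \<beta>(1) \<alpha>X cC c_agree[OF F(2,3) \<alpha>X] by auto
    moreover have "\<alpha> \<in> P \<xi>" unfolding P_def using \<alpha>(1) X[OF F(2)] cC unfolding c_def by auto
    ultimately have "\<alpha> \<in> b" using J3(4) J(5,6) \<xi>(3) by blast
    then have "\<alpha> \<in> a \<xi>'" using A(3) \<xi>(1,2) \<alpha>(1) by blast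
    then show False using \<alpha>(2) by simp
  qed
  then show ?thesis using A(1,2) J3F by (intro exI[of _ A]) auto
qed

section \<open>The function and its property\<close>

text \<open>For a pair \<open>s\<close>, coherence shows that members of equal rank containing
  \<open>s\<close> have the same elements below both points, so the choice of
  \<open>least_member s\<close> does not affect the value.\<close>

definition Delta_fun :: "'a set set set \<Rightarrow> 'a set set set" where
  "Delta_fun s = {\<gamma> \<in> least_member s. \<forall>x\<in>s. olt R \<gamma> x}"

lemma Delta_fun_mem:
  assumes "s \<in> [Field R]\<^bsup>2\<^esup>"
  shows "Delta_fun s \<in> {B. B \<subseteq> Field R \<and> |B| \<le>o lam}"
proof -
  obtain x y where s: "s = {x, y}" "x \<in> Field R" "y \<in> Field R"
    using assms unfolding nsets_def card_2_iff by auto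
  have sub: "Delta_fun s \<subseteq> least_member s" unfolding Delta_fun_def by blast
  have m: "least_member s \<in> \<mu>" using least_member(1)[OF s(2,3)] s(1) by simp
  then have "|least_member s| \<le>o lam" using member_small less_Suc_iff by blast
  then show ?thesis using sub member_sub[OF m] card_of_mono1[OF sub] ordLeq_transitive by blast
qed

text \<open>Coherence at \<alpha> carries elements below \<alpha> from
  \<open>least_member {\<tau>, \<alpha>}\<close> into
  \<open>least_member {\<alpha>, \<beta>}\<close>, which gives the first two conditions; the third
  uses coherence at \<beta>.\<close>

lemma Delta_fun_conditions:
  assumes F: "\<tau> \<in> Field R" "\<alpha> \<in> Field R" "\<beta> \<in> Field R" and \<alpha>\<beta>: "olt R \<alpha> \<beta>"
    and le: "olt R \<tau> \<beta> \<Longrightarrow> least_member {\<tau>, \<alpha>} \<preceq> least_member {\<alpha>, \<beta>}"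
  shows "olt R \<tau> \<alpha> \<and> olt R \<tau> \<beta> \<longrightarrow> \<tau> \<in> Delta_fun {\<alpha>, \<beta>}"
    and "olt R \<tau> \<beta> \<longrightarrow> Delta_fun {\<alpha>, \<tau>} \<subseteq> Delta_fun {\<alpha>, \<beta>}"
    and "olt R \<tau> \<alpha> \<longrightarrow> Delta_fun {\<beta>, \<tau>} \<subseteq> Delta_fun {\<alpha>, \<beta>}"
proof -
  have olt_trans: "olt R x z" if "olt R x y" "olt R y z" for x y z
    using that R_trans R_antisym unfolding olt_def by metis
  note M\<tau>\<alpha> = least_member[OF F(1,2)] and M\<alpha>\<beta> = least_member[OF F(2,3)] and M\<tau>\<beta> = least_member[OF F(1,3)]
  have in_M: "\<gamma> \<in> least_member {\<alpha>, \<beta>}" if "\<gamma> \<in> least_member {\<tau>, \<alpha>}" "olt R \<gamma> \<alpha>" "olt R \<tau> \<beta>" for \<gamma>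
    using coherence[OF M\<tau>\<alpha>(1) M\<alpha>\<beta>(1) le[OF that(3)] M\<tau>\<alpha>(3) M\<alpha>\<beta>(2) that(1)] that(2) by (simp add: olt_def)
  show "olt R \<tau> \<alpha> \<and> olt R \<tau> \<beta> \<longrightarrow> \<tau> \<in> Delta_fun {\<alpha>, \<beta>}"
    unfolding Delta_fun_def using in_M M\<tau>\<alpha>(2) by simp
  show "olt R \<tau> \<beta> \<longrightarrow> Delta_fun {\<alpha>, \<tau>} \<subseteq> Delta_fun {\<alpha>, \<beta>}"
    unfolding Delta_fun_def using in_M olt_trans[OF _ \<alpha>\<beta>] by (auto simp: insert_commute)
  show "olt R \<tau> \<alpha> \<longrightarrow> Delta_fun {\<beta>, \<tau>} \<subseteq> Delta_fun {\<alpha>, \<beta>}"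
  proof (intro impI subsetI)
    fix \<gamma> assume \<tau>\<alpha>: "olt R \<tau> \<alpha>" and "\<gamma> \<in> Delta_fun {\<beta>, \<tau>}"
    then have \<gamma>: "\<gamma> \<in> least_member {\<tau>, \<beta>}" "olt R \<gamma> \<beta>" "olt R \<gamma> \<tau>"
      unfolding Delta_fun_def by (auto simp: insert_commute)
    \<comment> \<open>Once \<tau> is in this member, minimality gives \<rho>(\<tau>, \<beta>) \<le>
      \<rho>(\<alpha>, \<beta>).\<close>
    have "\<tau> \<in> least_member {\<alpha>, \<beta>}" using in_M[OF M\<tau>\<alpha>(2) \<tau>\<alpha>] olt_trans[OF \<tau>\<alpha> \<alpha>\<beta>] by simp
    then have "least_member {\<tau>, \<beta>} \<preceq> least_member {\<alpha>, \<beta>}" by (rule least_member_le[OF M\<alpha>\<beta>(1) _ M\<alpha>\<beta>(3)])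
    then have "\<gamma> \<in> least_member {\<alpha>, \<beta>}"
      using coherence[OF M\<tau>\<beta>(1) M\<alpha>\<beta>(1) _ M\<tau>\<beta>(3) M\<alpha>\<beta>(3) \<gamma>(1)] \<gamma>(2) by (simp add: olt_def)
    then show "\<gamma> \<in> Delta_fun {\<alpha>, \<beta>}"
      unfolding Delta_fun_def using \<gamma>(2) olt_trans[OF \<gamma>(3) \<tau>\<alpha>] by simp
  qed
qed

lemma collectionwise_Delta_Delta_fun: "collectionwise_Delta lam Delta_fun"
  unfolding collectionwise_Delta_def Let_def
proof (intro allI impI)
  fix a :: "'a set \<Rightarrow> 'a set set set"
  assume a: "\<forall>\<xi>\<in>Field (cardSuc lam). a \<xi> \<subseteq> Field R \<and> |a \<xi>| <o lam"
  from thinning[OF a] obtain A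
    where A: "A \<subseteq> Field (cardSuc lam)" "|A| =o cardSuc lam"
    "\<forall>\<xi>\<in>A. \<forall>\<xi>'\<in>A. \<xi> \<noteq> \<xi>' \<longrightarrow>
      (\<forall>\<tau> \<in> a \<xi> \<inter> a \<xi>'. \<forall>\<alpha> \<in> a \<xi> - a \<xi>'. \<forall>\<beta> \<in> a \<xi>' - a \<xi>. olt R \<alpha> \<beta> \<longrightarrow> olt R \<tau> \<beta> \<longrightarrow>
        least_member {\<tau>, \<alpha>} \<preceq> least_member {\<alpha>, \<beta>})"
    by (elim exE conjE)
  have "(olt R \<tau> \<alpha> \<and> olt R \<tau> \<beta> \<longrightarrow> \<tau> \<in> Delta_fun {\<alpha>, \<beta>}) \<and>
      (olt R \<tau> \<beta> \<longrightarrow> Delta_fun {\<alpha>, \<tau>} \<subseteq> Delta_fun {\<alpha>, \<beta>}) \<and>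
      (olt R \<tau> \<alpha> \<longrightarrow> Delta_fun {\<beta>, \<tau>} \<subseteq> Delta_fun {\<alpha>, \<beta>})"
    if H: "\<xi> \<in> A" "\<xi>' \<in> A" "\<xi> \<noteq> \<xi>'" "\<tau> \<in> a \<xi> \<inter> a \<xi>'" "\<alpha> \<in> a \<xi> - a \<xi>'" "\<beta> \<in> a \<xi>' - a \<xi>" for \<xi> \<xi>' \<tau> \<alpha> \<beta>
  proof -
    have "a \<xi> \<subseteq> Field R" "a \<xi>' \<subseteq> Field R" using a A(1) H(1,2) by blast+
    then have F: "\<tau> \<in> Field R" "\<alpha> \<in> Field R" "\<beta> \<in> Field R" using H(4-6) by auto
    have "\<alpha> \<noteq> \<beta>" using H(5,6) by blast
    then consider "olt R \<alpha> \<beta>" | "olt R \<beta> \<alpha>" using R_total[OF F(2,3)] unfolding olt_def by blast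
    then show ?thesis
    proof cases
      case 1
      have "least_member {\<tau>, \<alpha>} \<preceq> least_member {\<alpha>, \<beta>}" if "olt R \<tau> \<beta>"
        using A(3)[rule_format, OF H(1-6) 1 that] .
      then show ?thesis using Delta_fun_conditions[OF F 1] by simp
    next
      \<comment> \<open>Exchanging \<xi> with \<xi>' and \<alpha> with \<beta> interchanges the
        second and third conditions.\<close>
      case 2
      have "\<tau> \<in> a \<xi>' \<inter> a \<xi>" using H(4) by blast
      then have "least_member {\<tau>, \<beta>} \<preceq> least_member {\<beta>, \<alpha>}" if "olt R \<tau> \<alpha>"
        using A(3)[rule_format, OF H(2,1) H(3)[symmetric] _ H(6,5) 2 that] by simp
      then show ?thesis using Delta_fun_conditions[OF F(1,3,2) 2] by (simp add: insert_commute)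
    qed
  qed
  then show "\<exists>A\<subseteq>Field (cardSuc lam). |A| =o cardSuc lam \<and>
      (\<forall>\<xi>\<in>A. \<forall>\<xi>'\<in>A. \<xi> \<noteq> \<xi>' \<longrightarrow>
        (\<forall>\<tau> \<in> a \<xi> \<inter> a \<xi>'. \<forall>\<alpha> \<in> a \<xi> - a \<xi>'. \<forall>\<beta> \<in> a \<xi>' - a \<xi>.
          (olt R \<tau> \<alpha> \<and> olt R \<tau> \<beta> \<longrightarrow> \<tau> \<in> Delta_fun {\<alpha>, \<beta>}) \<and>
          (olt R \<tau> \<beta> \<longrightarrow> Delta_fun {\<alpha>, \<tau>} \<subseteq> Delta_fun {\<alpha>, \<beta>}) \<and>
          (olt R \<tau> \<alpha> \<longrightarrow> Delta_fun {\<beta>, \<tau>} \<subseteq> Delta_fun {\<alpha>, \<beta>})))"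
    using A(1,2) by (intro exI[of _ A] conjI ballI impI) simp_all
qed

end

theorem theorem5p12:
  fixes lam :: "'a rel"
  assumes "Cinfinite lam" and "regularCard lam"
    and "weak_power lam =o lam"
    and "\<exists>\<mu>. two_cardinal (cardSuc lam) \<mu>"
  shows "\<exists>f \<in> [Field (cardSuc (cardSuc lam))]\<^bsup>2\<^esup> \<rightarrow>
                {B. B \<subseteq> Field (cardSuc (cardSuc lam)) \<and> |B| \<le>o lam}.
           collectionwise_Delta lam f"
proof -
  obtain \<mu> where \<mu>: "two_cardinal (cardSuc lam) \<mu>" using assms(4) by blast
  interpret Delta_setting lam \<mu>
    using assms(1-3) \<mu> by unfold_locales
  show ?thesis
    using collectionwise_Delta_Delta_fun Delta_fun_mem by (intro bexI[of _ Delta_fun] Pi_I)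
qed

end
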